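(* Let $(f,F):(A,M,I)\to(B,N,J)$ be a morphism of $A_\infty$ algebras with $A_\infty$ modules and $A_\infty$ inner products over a commutative unital ring $R$. Let $k,\ell\ge0$ with $k+\ell\ge1$. Then for all $(a_1,\dots,a_k,m_{k+1},a_{k+2},\dots,a_{k+\ell+1},m_{k+\ell+2})\in A^{\times k}\times M\times A^{\times\ell}\times M$ there is an inclusion of Massey inner product sets $$\langle a_1,\dots,a_k,m_{k+1},a_{k+2},\dots,a_{k+\ell+1},m_{k+\ell+2}\rangle_I\subseteq\langle f_1(a_1),\dots,f_1(a_k),F_{0,0}(m_{k+1}),f_1(a_{k+2}),\dots,f_1(a_{k+\ell+1}),F_{0,0}(m_{k+\ell+2})\rangle_J\subseteq R.$$
   Context: Shift and $A_\infty$ algebras. For a graded $R$-module $A=\bigoplus_{k\ge0}A_k$, $\underline A$ is $A$ shifted down by one: $|\underline a|=|a|-1$; $\mathfrak s:A\to\underline A$, $a\mapsto\underline a$. An $A_\infty$ algebra has maps $\mu_k:A^{\otimes k}\to A$ ($k\ge1$) of degree $2-k$ whose shifts $\underline{\mu_k}=\mathfrak s\circ\mu_k\circ(\mathfrak s^{-1})^{\otimes k}$ (of degree $1$) satisfy, for all $n\ge1$, $\sum_{k+\ell-1=n}\sum_{i+j+1=k}\underline{\mu_k}\circ(id^{\otimes i}\otimes\underline{\mu_\ell}\otimes id^{\otimes j})=0$. All signs are given by the Koszul rule in shifted degrees; underlines denote shifted versions of maps and elements. $d=\mu_1$. Elements are homogeneous. A morphism $f:(A,\mu)\to(B,\nu)$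 of $A_\infty$ algebras consists of maps $f_k:A^{\otimes k}\to B$ ($k\ge1$) of degree $1-k$ whose shifts (of degree $0$) satisfy, for all $n\ge 1$, $\sum_{k+\ell-1=n}\sum_{i+j+1=k}\underline{f_k}(id^{\otimes i}\otimes\underline{\mu_\ell}\otimes id^{\otimes j})=\sum_{\ell_1+\dots+\ell_k=n}\underline{\nu_k}(\underline{f_{\ell_1}}\otimes\dots\otimes\underline{f_{\ell_k}})$. $A_\infty$ modules. An $A_\infty$ module $M$ over $A$ has maps $\beta_{k,\ell}:A^{\otimes k}\otimes M\otimes A^{\otimes\ell}\to M$ ($k,\ell\ge0$) of degree $1-k-\ell$ whose shifts (of degree $1$) satisfy, for all $r,s\ge0$, $\sum_{k+\ell-1=r}\sum_{i+j+1=k}\underline{\beta_{k,s}}(id^{\otimes i}\otimes\underline{\mu_\ell}\otimes id^{\otimes j}\otimes id_{\underline M}\otimes id^{\otimes s})+\sum_{k+i=r,\,\ell+j=s}\underline{\beta_{i,j}}(id^{\otimes i}\otimes\underline{\beta_{k,\ell}}\otimes id^{\otimes j})+\sum_{k+\ell-1=s}\sum_{i+j+1=k}\underline{\beta_{r,k}}(id^{\otimes r}\otimes id_{\underline M}\otimes id^{\otimes i}\otimes\underline{\mu_\ell}\otimes id^{\otimes j})=0$. The differential of $M$ is $d=\beta_{0,0}$. For a family $F$ of maps $F_{k,\ell}:A^{\otimes k}\otimes M\otimes A^{\otimes\ell}\to N$ of degree $|F|-k-\ell$, let $\underline{(F\circ\beta)_{r,s}}$ be the expression of the previous display with the outer maps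 $\underline{\beta_{k,s}},\underline{\beta_{i,j}},\underline{\beta_{r,k}}$ replaced by $\underline{F_{k,s}},\underline{F_{i,j}},\underline{F_{r,k}}$. If $f:A\to B$ is a morphism of $A_\infty$ algebras, $(M,\beta)$ a module over $A$, $(N,\gamma)$ a module over $B$, then $F$ is a morphism of $A_\infty$ modules (of degree $|F|$) over $f$ if for all $r,s\geq 0$, $\underline{(F\circ\beta)_{r,s}}=(-1)^{|F|}\sum_{k+k_1+\dots+k_i=r}\sum_{\ell+\ell_1+\dots+\ell_j=s}\underline{\gamma_{i,j}}(\underline{f_{k_1}}\otimes\dots\otimes\underline{f_{k_i}}\otimes\underline{F_{k,\ell}}\otimes\underline{f_{\ell_1}}\otimes\dots\otimes\underline{f_{\ell_j}})$. If $M$, $N$ are both modules over $A$, define $\delta(F)$ on any family $F$ by $\underline{\delta(F)_{r,s}}=\underline{(F\circ\beta)_{r,s}}-(-1)^{|F|}\sum_{k+i=r,\,\ell+j=s}\underline{\gamma_{i,j}}(id^{\otimes i}\otimes\underline{F_{k,\ell}}\otimes id^{\otimes j})$; thus $\delta(F)=0$ iff $F$ is a morphism over $id_A$. Dual module and inner products. $M^*=Hom(M,R)$ is an $A_\infty$ module over $A$ via $\underline{\beta'_{k,\ell}}(\underline{a_1},\dots,\underline{a_k},\underline{m^*},\underline{\tilde a_1},\dots,\underline{\tilde a_\ell})(\underline{\tilde m})=-(-1)^{\varepsilon}\,\underline{m^*}(\underline{\beta_{\ell,k}}(\underline{\tilde a_1},\dots,\underline{\tilde a_\ell},\underline{\tilde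 m},\underline{a_1},\dots,\underline{a_k}))$, with $\varepsilon=(|\underline{a_1}|+\dots+|\underline{a_k}|)(|\underline{m^*}|+|\underline{\tilde a_1}|+\dots+|\underline{\tilde a_\ell}|+|\underline{\tilde m}|)+|\underline{m^*}|$; elements of the shift of $M^*$ are evaluated on $\underline M$ by $\underline{m^*}(\underline m)=m^*(m)$. An $A_\infty$ inner product on $M$ is a morphism $I:M\to M^*$ of $A_\infty$ modules over $id_A$. It is exact if $I=\delta(G)$ for some family $G=\{G_{k,\ell}:A^{\otimes k}\otimes M\otimes A^{\otimes\ell}\to M^*\}$. Pullback. For $f:A\to B$ a morphism of $A_\infty$ algebras, $F:M\to N$ a morphism of $A_\infty$ modules over $f$, and $J$ an $A_\infty$ inner product on $N$, the pulled back $A_\infty$ inner product $F^\sharp(J)$ on $M$ is $\underline{F^\sharp(J)_{k,\ell}}(\underline{a_1},\dots,\underline{a_k},\underline m,\underline{\tilde a_1},\dots,\underline{\tilde a_\ell})(\underline{\tilde m})=\sum(-1)^{\varepsilon}\big(\underline{J_{i,j}}(\underline{f_{r_1}}\otimes\dots\otimes\underline{f_{r_i}}\otimes\underline{F_{r,s}}\otimes\underline{f_{s_1}}\otimes\dots\otimes\underline{f_{s_j}})(\underline{a_{k-p+1}},\dots,\underline{a_k},\underline m,\underline{\tilde a_1},\dots,\underline{\tilde a_q})\big)\big(\underline{F_{\ell-q,k-p}}(\underline{\tilde a_{q+1}},\dots,\underline{\tilde a_\ell},\underline{\tilde m},\underline{a_1},\dots,\underline{a_{k-p}})\big)$, summed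 over $0\le p\le k$, $0\le q\le\ell$, $r+r_1+\dots+r_i=p$, $s+s_1+\dots+s_j=q$, with $(-1)^\varepsilon$ the Koszul sign. Morphisms of triples. For triples $(A,M,I)$, $(B,N,J)$ of an $A_\infty$ algebra, an $A_\infty$ module over it and an $A_\infty$ inner product on the module, a morphism $(f,F):(A,M,I)\to(B,N,J)$ consists of a morphism $f:A\to B$ of $A_\infty$ algebras and a morphism $F:M\to N$ of $A_\infty$ modules over $f$ such that $F^\sharp(J)-I$ is an exact $A_\infty$ inner product. Cyclic defining systems. Put $n=k+\ell+2$ and let $(x_1,\dots,x_n)\in A^{\times k}\times M\times A^{\times\ell}\times M$ (so $x_{k+1},x_n\in M$). A cyclic triangular system consists of a family $(x_{i,j})_{1\le i\le j\le n-1}$ and a family $(x'_{i,j})$ indexed by pairs $i\preceq j$ in the linear order $k+2\prec\dots\prec n\prec1\prec\dots\prec k$ (corner entries of both families included), with $x_{i,i}=x_i$, $x'_{i,i}=x_i$; $x_{i,j}\in M$ if $i\le k+1\le j$ and $x_{i,j}\in A$ otherwise; $x'_{i,j}\in M$ if $i\preceq n\preceq j$ and $x'_{i,j}\in A$ otherwise; the shifted degree $|\underline{x_{i,j}}|$ (resp. $|\underline{x'_{i,j}}|$) equals $\sum|\underline{x_m}|$ over $m$ from $i$ to $j$ in the respective order; and $x_{i,j}=x'_{i,j}$ whenever $1\le i\le j\le k$ or $k+2\le i\le j\le k+\ell+1$. The staircase product $\mathcal S^{i,j}$ of either family is defined by letting $\underline{\mathcal S^{i,j}}$ be the sum, over all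 ways of cutting the interval from $i$ to $j$ (in the respective order) into $t\ge2$ consecutive nonempty subintervals $[u_1,v_1],\dots,[u_t,v_t]$, of $\underline{\mu_t}$ (if all entries are in $A$) or $\underline{\beta_{r,s}}$ with $r+s+1=t$ (if the $(r+1)$-st entry is in $M$) applied to the shifted entries with indices $(u_1,v_1),\dots,(u_t,v_t)$. The system is a cyclic defining system if $d(x_{i,j})=-\mathcal S^{i,j}(\{x_{\bullet\bullet}\})$ and $d(x'_{i,j})=-\mathcal S^{i,j}(\{x'_{\bullet\bullet}\})$ for all $(i,j)$, corners included. Massey inner product. The staircase inner product of a cyclic defining system is $\mathcal I=\sum(-1)^{\varepsilon}\,\underline{I_{r,s}}(\underline{x_{u_1,v_1}},\dots,\underline{x_{u_{r+s+1},v_{r+s+1}}})(\underline{x'_{q+1,p-1}})\in R$, summed over all $1\le p\le k+1\le q\le k+\ell+1$ and all ways of cutting $[p,q]$ into consecutive nonempty subintervals $[u_1,v_1],\dots,[u_{r+s+1},v_{r+s+1}]$, where the $(r+1)$-st is the one containing $k+1$; for $p=1$, $p-1$ means $k+\ell+2$; and $\varepsilon=(|\underline{x_1}|+\dots+|\underline{x_{p-1}}|)(|\underline{x_p}|+\dots+|\underline{x_n}|)$. For $k+\ell\ge1$ the $(k,\ell)^{th}$ Massey inner product set $\langle x_1,\dots,x_n\rangle_I\subseteq R$ is the set of all values $\mathcal I$ over all cyclic defining systems for $(x_1,\dots,x_n)$ (the empty set if there are none).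
   Formalization: The module morphism F is assumed to have even degree (degree 0 included); for odd |F| the inclusion can fail by an overall sign, e.g. with all structure maps zero and I the pullback of J one gets the sets {-1} and {1}. *)

theory Defs
  imports Complex_Main "HOL-Library.Function_Algebras"
begin

subsection \<open>Graded modules\<close>

text \<open>The underlying module is the whole type; \<open>component G d\<close> is the submodule of elements of
  (unshifted) degree \<open>d\<close>.  Degrees are integers because the dual of a module lives in
  nonpositive degrees.\<close>

record ('r, 'a) gmod =
  scal :: "'r \<Rightarrow> 'a \<Rightarrow> 'a"
  component :: "int \<Rightarrow> 'a set"

definition graded_module :: "('r::comm_ring_1, 'a::ab_group_add, 'z) gmod_scheme \<Rightarrow> bool" where
  "graded_module G \<longleftrightarrow>
     module (scal G) \<and>
     (\<forall>d. module.subspace (scal G) (component G d)) \<and>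
     (\<forall>x. \<exists>!h. (\<forall>d. h d \<in> component G d) \<and> finite {d. h d \<noteq> 0} \<and> x = (\<Sum>d | h d \<noteq> 0. h d))"

subsection \<open>Shifted homogeneous elements and shifted maps\<close>

text \<open>A pair \<open>(d, x)\<close> stands for the shift of a homogeneous element \<open>x\<close>, tagged with its
  \<^emph>\<open>shifted\<close> degree \<open>d\<close>, so \<open>x\<close> has degree \<open>d + 1\<close>.  The tag is part of the data since the zero
  element is homogeneous of every degree.\<close>

type_synonym 'a tagged = "int \<times> 'a"

definition homog :: "('r, 'a, 'z) gmod_scheme \<Rightarrow> 'a tagged \<Rightarrow> bool" where
  "homog G x \<longleftrightarrow> snd x \<in> component G (fst x + 1)"

definition sg :: "int \<Rightarrow> 'a::ab_group_add \<Rightarrow> 'a" where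
  "sg e x = (if even e then x else - x)"

definition deg :: "'a tagged list \<Rightarrow> int" where
  "deg xs = sum_list (map fst xs)"

text \<open>Exponent of the Koszul sign of the tensor power of the inverse shift (a map of degree \<open>1\<close>)
  applied to elements of shifted degrees \<open>ds\<close>: the \<open>j\<close>-th element is passed by all inverse shifts
  to the right of the \<open>j\<close>-th one.\<close>

fun unshift_exp :: "int list \<Rightarrow> int" where
  "unshift_exp [] = 0"
| "unshift_exp (d # ds) = int (length ds) * d + unshift_exp ds"

text \<open>A family of maps on tensor powers is a function on lists; its \<open>k\<close>-th member is the restriction
  to lists of length \<open>k\<close>.  Below, \<open>sh_val h\<close> and \<open>shm_val F\<close> are the values of the shifted maps, and
  \<open>sh c h\<close> and \<open>shm c F\<close> are these values tagged with their degree, where \<open>c\<close> is the degree of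
  the shifted map.\<close>

definition sh_val :: "('a list \<Rightarrow> 'b::ab_group_add) \<Rightarrow> 'a tagged list \<Rightarrow> 'b" where
  "sh_val h xs = sg (unshift_exp (map fst xs)) (h (map snd xs))"

definition sh :: "int \<Rightarrow> ('a list \<Rightarrow> 'b::ab_group_add) \<Rightarrow> 'a tagged list \<Rightarrow> 'b tagged" where
  "sh c h xs = (deg xs + c, sh_val h xs)"

definition shm_val ::
  "('a list \<Rightarrow> 'm \<Rightarrow> 'a list \<Rightarrow> 'n::ab_group_add) \<Rightarrow>
   'a tagged list \<Rightarrow> 'm tagged \<Rightarrow> 'a tagged list \<Rightarrow> 'n" where
  "shm_val F as m bs =
     sg (unshift_exp (map fst as @ fst m # map fst bs)) (F (map snd as) (snd m) (map snd bs))"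

definition shm ::
  "int \<Rightarrow> ('a list \<Rightarrow> 'm \<Rightarrow> 'a list \<Rightarrow> 'n::ab_group_add) \<Rightarrow>
   'a tagged list \<Rightarrow> 'm tagged \<Rightarrow> 'a tagged list \<Rightarrow> 'n tagged" where
  "shm c F as m bs = (deg as + fst m + deg bs + c, shm_val F as m bs)"

text \<open>\<open>alg_family A B c h\<close>: for \<open>k \<ge> 1\<close> the map \<open>h\<^sub>k\<close> is multilinear of degree \<open>c - k\<close>.  The value
  of \<open>h\<close> at the empty list is irrelevant.\<close>

definition alg_family ::
  "('r::comm_ring_1, 'a::ab_group_add, 'y) gmod_scheme \<Rightarrow> ('r, 'b::ab_group_add, 'z) gmod_scheme \<Rightarrow>
   int \<Rightarrow> ('a list \<Rightarrow> 'b) \<Rightarrow> bool" where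
  "alg_family A B c h \<longleftrightarrow>
     (\<forall>us ws. module_hom (scal A) (scal B) (\<lambda>x. h (us @ x # ws))) \<and>
     (\<forall>xs ds. xs \<noteq> [] \<and> list_all2 (\<lambda>x d. x \<in> component A d) xs ds \<longrightarrow>
        h xs \<in> component B (sum_list ds + c - int (length xs)))"

definition mod_family ::
  "('r::comm_ring_1, 'a::ab_group_add, 'x) gmod_scheme \<Rightarrow> ('r, 'm::ab_group_add, 'y) gmod_scheme \<Rightarrow>
   ('r, 'n::ab_group_add, 'z) gmod_scheme \<Rightarrow> int \<Rightarrow> ('a list \<Rightarrow> 'm \<Rightarrow> 'a list \<Rightarrow> 'n) \<Rightarrow> bool" where
  "mod_family A M N c F \<longleftrightarrow>
     (\<forall>as bs. module_hom (scal M) (scal N) (\<lambda>m. F as m bs)) \<and>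
     (\<forall>us ws m bs. module_hom (scal A) (scal N) (\<lambda>x. F (us @ x # ws) m bs)) \<and>
     (\<forall>as m us ws. module_hom (scal A) (scal N) (\<lambda>x. F as m (us @ x # ws))) \<and>
     (\<forall>as ds m d bs es.
        list_all2 (\<lambda>x d. x \<in> component A d) as ds \<and> m \<in> component M d \<and>
        list_all2 (\<lambda>x d. x \<in> component A d) bs es \<longrightarrow>
        F as m bs \<in> component N (sum_list ds + d + sum_list es + c - int (length as) - int (length bs)))"

subsection \<open>Decompositions of lists\<close>

definition splits2 :: "'x list \<Rightarrow> ('x list \<times> 'x list) set" where
  "splits2 xs = {(u, v). u @ v = xs}"

definition splits3 :: "'x list \<Rightarrow> ('x list \<times> 'x list \<times> 'x list) set" where
  "splits3 xs = {(u, v, w). u @ v @ w = xs}"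

definition inner_splits :: "'x list \<Rightarrow> ('x list \<times> 'x list \<times> 'x list) set" where
  "inner_splits xs = {(u, v, w). u @ v @ w = xs \<and> v \<noteq> []}"

definition cuts :: "'x list \<Rightarrow> 'x list list set" where
  "cuts xs = {bss. concat bss = xs \<and> [] \<notin> set bss}"

text \<open>Cuts with a distinguished block, namely one containing \<open>c\<close>.\<close>

definition mcuts :: "'x \<Rightarrow> 'x list \<Rightarrow> ('x list list \<times> 'x list \<times> 'x list list) set" where
  "mcuts c xs = {(pre, b, post). pre @ b # post \<in> cuts xs \<and> c \<in> set b}"

text \<open>All sums below range over these sets, so their finiteness matters.\<close>

lemma finite_splits2: "finite (splits2 xs)"
proof (rule finite_subset)
  show "splits2 xs \<subseteq> (\<lambda>i. (take i xs, drop i xs)) ` {..length xs}"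
  proof
    fix t assume "t \<in> splits2 xs"
    then obtain u v where t: "t = (u, v)" "u @ v = xs" by (auto simp: splits2_def)
    show "t \<in> (\<lambda>i. (take i xs, drop i xs)) ` {..length xs}"
      by (rule image_eqI[of _ _ "length u"]) (use t in auto)
  qed
qed simp

lemma finite_splits3: "finite (splits3 xs)"
proof (rule finite_subset)
  show "splits3 xs \<subseteq> (\<lambda>(i, j). (take i xs, take j (drop i xs), drop j (drop i xs))) `
      ({..length xs} \<times> {..length xs})"
  proof
    fix t assume "t \<in> splits3 xs"
    then obtain u v w where t: "t = (u, v, w)" "xs = u @ v @ w" by (auto simp: splits3_def)
    show "t \<in> (\<lambda>(i, j). (take i xs, take j (drop i xs), drop j (drop i xs))) `
        ({..length xs} \<times> {..length xs})"
      by (rule image_eqI[of _ _ "(length u, length v)"]) (simp_all add: t)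
  qed
qed simp

lemma finite_inner_splits: "finite (inner_splits xs)"
  by (rule finite_subset[OF _ finite_splits3[of xs]]) (auto simp: inner_splits_def splits3_def)

lemma length_le_concat: "[] \<notin> set bss \<Longrightarrow> length bss \<le> length (concat bss)"
proof (induction bss)
  case (Cons b bss)
  then show ?case by (cases b) auto
qed simp

lemma finite_cuts: "finite (cuts xs)"
proof (rule finite_subset)
  let ?S = "{b. set b \<subseteq> set xs \<and> length b \<le> length xs}"
  show "cuts xs \<subseteq> {bss. set bss \<subseteq> ?S \<and> length bss \<le> length xs}"
  proof
    fix bss assume "bss \<in> cuts xs"
    then have bss: "xs = concat bss" "[] \<notin> set bss" by (auto simp: cuts_def)
    have "b \<in> ?S" if b: "b \<in> set bss" for b
    proof -
      from split_list[OF b] obtain ps qs where "bss = ps @ b # qs" by blast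
      then show ?thesis using bss(1) by auto
    qed
    then show "bss \<in> {bss. set bss \<subseteq> ?S \<and> length bss \<le> length xs}"
      using length_le_concat[OF bss(2)] bss(1) by blast
  qed
  show "finite {bss. set bss \<subseteq> ?S \<and> length bss \<le> length xs}"
    by (intro finite_lists_length_le) simp
qed

lemma finite_mcuts: "finite (mcuts c xs)"
proof (rule finite_imageD)
  let ?g = "\<lambda>(pre, b, post). (pre @ b # post, length pre)"
  show "inj_on ?g (mcuts c xs)"
    by (auto simp: inj_on_def)
  have "?g ` mcuts c xs \<subseteq> cuts xs \<times> {..length xs}"
  proof
    fix t assume "t \<in> ?g ` mcuts c xs"
    then obtain pre b post where t: "t = (pre @ b # post, length pre)" "pre @ b # post \<in> cuts xs"
      by (auto simp: mcuts_def)
    then have "length (pre @ b # post) \<le> length xs"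
      using length_le_concat by (metis (mono_tags, lifting) cuts_def mem_Collect_eq)
    then show "t \<in> cuts xs \<times> {..length xs}" using t by simp
  qed
  then show "finite (?g ` mcuts c xs)"
    by (rule finite_subset) (simp add: finite_cuts)
qed

subsection \<open>A-infinity algebras and their morphisms\<close>

record ('r, 'a) ainf_alg = "('r, 'a) gmod" +
  mu :: "'a list \<Rightarrow> 'a"

text \<open>By multilinearity it suffices to impose the structure equations on homogeneous elements.\<close>

definition ainf_algebra :: "('r::comm_ring_1, 'a::ab_group_add) ainf_alg \<Rightarrow> bool" where
  "ainf_algebra A \<longleftrightarrow>
     graded_module A \<and> (\<forall>d<0. component A d = {0}) \<and> alg_family A A 2 (mu A) \<and>
     (\<forall>xs. xs \<noteq> [] \<and> (\<forall>x\<in>set xs. homog A x) \<longrightarrow>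
        (\<Sum>(u, v, w)\<in>inner_splits xs. sg (deg u) (sh_val (mu A) (u @ sh 1 (mu A) v # w))) = 0)"

definition ainf_morphism ::
  "('r::comm_ring_1, 'a::ab_group_add) ainf_alg \<Rightarrow> ('r, 'b::ab_group_add) ainf_alg \<Rightarrow>
   ('a list \<Rightarrow> 'b) \<Rightarrow> bool" where
  "ainf_morphism A B f \<longleftrightarrow>
     alg_family A B 1 f \<and>
     (\<forall>xs. xs \<noteq> [] \<and> (\<forall>x\<in>set xs. homog A x) \<longrightarrow>
        (\<Sum>(u, v, w)\<in>inner_splits xs. sg (deg u) (sh_val f (u @ sh 1 (mu A) v # w))) =
        (\<Sum>bss\<in>cuts xs. sh_val (mu B) (map (sh 0 f) bss)))"

definition id_morphism :: "'a::zero list \<Rightarrow> 'a" where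
  "id_morphism xs = (case xs of [x] \<Rightarrow> x | _ \<Rightarrow> 0)"

subsection \<open>A-infinity modules and their morphisms\<close>

record ('r, 'a, 'm) ainf_mod = "('r, 'm) gmod" +
  act :: "'a list \<Rightarrow> 'm \<Rightarrow> 'a list \<Rightarrow> 'm"

definition comp_act ::
  "('r, 'a::ab_group_add) ainf_alg \<Rightarrow> ('r, 'a, 'm::ab_group_add) ainf_mod \<Rightarrow>
   ('a list \<Rightarrow> 'm \<Rightarrow> 'a list \<Rightarrow> 'n::ab_group_add) \<Rightarrow>
   'a tagged list \<Rightarrow> 'm tagged \<Rightarrow> 'a tagged list \<Rightarrow> 'n" where
  "comp_act A M F as m bs =
     (\<Sum>(u, v, w)\<in>inner_splits as. sg (deg u) (shm_val F (u @ sh 1 (mu A) v # w) m bs)) +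
     (\<Sum>(u, u')\<in>splits2 as. \<Sum>(w', w)\<in>splits2 bs.
        sg (deg u) (shm_val F u (shm 1 (act M) u' m w') w)) +
     (\<Sum>(u, v, w)\<in>inner_splits bs.
        sg (deg as + fst m + deg u) (shm_val F as m (u @ sh 1 (mu A) v # w)))"

definition ainf_module ::
  "('r::comm_ring_1, 'a::ab_group_add) ainf_alg \<Rightarrow> ('r, 'a, 'm::ab_group_add) ainf_mod \<Rightarrow> bool" where
  "ainf_module A M \<longleftrightarrow>
     graded_module M \<and> mod_family A M M 1 (act M) \<and>
     (\<forall>as m bs. (\<forall>x\<in>set as \<union> set bs. homog A x) \<and> homog M m \<longrightarrow>
        comp_act A M (act M) as m bs = 0)"

text \<open>\<open>module_morphism A M N g f c F\<close>: \<open>F\<close> is a morphism of degree \<open>c\<close> over \<open>f\<close> from \<open>M\<close> to the graded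
  module \<open>N\<close> whose \<^emph>\<open>shifted\<close> structure maps are \<open>g\<close>.  The shifted structure maps are an argument of
  their own because those of a dual module are given by a formula on shifted homogeneous elements.\<close>

definition module_morphism ::
  "('r::comm_ring_1, 'a::ab_group_add) ainf_alg \<Rightarrow> ('r, 'a, 'm::ab_group_add) ainf_mod \<Rightarrow>
   ('r, 'n::ab_group_add, 'z) gmod_scheme \<Rightarrow>
   ('b::ab_group_add tagged list \<Rightarrow> 'n tagged \<Rightarrow> 'b tagged list \<Rightarrow> 'n) \<Rightarrow>
   ('a list \<Rightarrow> 'b) \<Rightarrow> int \<Rightarrow> ('a list \<Rightarrow> 'm \<Rightarrow> 'a list \<Rightarrow> 'n) \<Rightarrow> bool" where
  "module_morphism A M N g f c F \<longleftrightarrow>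
     mod_family A M N c F \<and>
     (\<forall>as m bs. (\<forall>x\<in>set as \<union> set bs. homog A x) \<and> homog M m \<longrightarrow>
        comp_act A M F as m bs =
        sg c (\<Sum>(u, u')\<in>splits2 as. \<Sum>us\<in>cuts u. \<Sum>(w', w)\<in>splits2 bs. \<Sum>ws\<in>cuts w.
          sg (c * deg u) (g (map (sh 0 f) us) (shm c F u' m w') (map (sh 0 f) ws))))"

text \<open>The shift of \<open>\<delta>(F)\<close> for a family \<open>F\<close> of degree \<open>c\<close>; \<open>g\<close> is as above.\<close>

definition delta ::
  "('r, 'a::ab_group_add) ainf_alg \<Rightarrow> ('r, 'a, 'm::ab_group_add) ainf_mod \<Rightarrow>
   ('a tagged list \<Rightarrow> 'n::ab_group_add tagged \<Rightarrow> 'a tagged list \<Rightarrow> 'n) \<Rightarrow>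
   int \<Rightarrow> ('a list \<Rightarrow> 'm \<Rightarrow> 'a list \<Rightarrow> 'n) \<Rightarrow>
   'a tagged list \<Rightarrow> 'm tagged \<Rightarrow> 'a tagged list \<Rightarrow> 'n" where
  "delta A M g c F as m bs =
     comp_act A M F as m bs -
     sg c (\<Sum>(u, u')\<in>splits2 as. \<Sum>(w', w)\<in>splits2 bs. sg (c * deg u) (g u (shm c F u' m w') w))"

subsection \<open>Dual modules and inner products\<close>

text \<open>Component \<open>d\<close> of the dual consists of the linear forms concentrated on component \<open>- d\<close>.\<close>

definition dual :: "('r::comm_ring_1, 'm::ab_group_add, 'z) gmod_scheme \<Rightarrow> ('r, 'm \<Rightarrow> 'r) gmod" where
  "dual M = \<lparr>scal = (\<lambda>r \<phi> x. r * \<phi> x),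
     component = (\<lambda>d. {\<phi>. module_hom (scal M) (*) \<phi> \<and>
       (\<forall>d' x. d' \<noteq> - d \<and> x \<in> component M d' \<longrightarrow> \<phi> x = 0)})\<rparr>"

text \<open>The shifted structure maps of the dual.  The sign involves the shifted degree of the element at
  which the resulting form is evaluated.  For degree reasons the form is nonzero only on the
  component of shifted degree \<open>dm\<close> below, so that this degree can be put in the sign, which gives a form
  that is linear on all of \<open>M\<close>; see the lemma following the definition for the formula at an
  arbitrary homogeneous element.\<close>

definition dual_act_val ::
  "('r, 'a, 'm::ab_group_add) ainf_mod \<Rightarrow>
   'a tagged list \<Rightarrow> ('m \<Rightarrow> 'r::comm_ring_1) tagged \<Rightarrow> 'a tagged list \<Rightarrow> 'm \<Rightarrow> 'r" where
  "dual_act_val M as \<phi> bs = (\<lambda>x.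
     let dm = - (deg as + fst \<phi> + deg bs + 3) in
     - sg (deg as * (fst \<phi> + deg bs + dm) + fst \<phi>) (snd \<phi> (shm_val (act M) bs (dm, x) as)))"

lemma sg_mem: "module s \<Longrightarrow> module.subspace s V \<Longrightarrow> x \<in> V \<Longrightarrow> sg e x \<in> V"
  by (simp add: sg_def module.subspace_neg)

lemma sum_list_shifted_degrees: "(\<Sum>x\<leftarrow>xs. fst x + 1) = deg xs + int (length xs)"
  by (induction xs) (auto simp: deg_def)

lemma homog_shm:
  assumes "graded_module N" "mod_family A M N c F"
    "\<forall>x\<in>set as \<union> set bs. homog A x" "homog M m"
  shows "homog N (shm c F as m bs)"
proof -
  have l: "list_all2 (\<lambda>x d. x \<in> component A d) (map snd xs) (map (\<lambda>x. fst x + 1) xs)"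
    if "\<forall>x\<in>set xs. homog A x" for xs
    using that by (induction xs) (auto simp: homog_def)
  have "\<forall>x\<in>set as. homog A x" "\<forall>x\<in>set bs. homog A x" "snd m \<in> component M (fst m + 1)"
    using assms(3,4) by (auto simp: homog_def)
  then have "F (map snd as) (snd m) (map snd bs) \<in> component N (sum_list (map (\<lambda>x. fst x + 1) as) +
     (fst m + 1) + sum_list (map (\<lambda>x. fst x + 1) bs) + c - int (length (map snd as)) - int (length (map snd bs)))"
    using l by (intro assms(2)[unfolded mod_family_def, THEN conjunct2, THEN conjunct2,
      THEN conjunct2, rule_format] conjI)
  moreover have "sum_list (map (\<lambda>x. fst x + 1) as) + (fst m + 1) + sum_list (map (\<lambda>x. fst x + 1) bs) + c
      - int (length (map snd as)) - int (length (map snd bs)) = deg as + fst m + deg bs + c + 1"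
    by (simp add: sum_list_shifted_degrees)
  ultimately have "F (map snd as) (snd m) (map snd bs) \<in> component N (deg as + fst m + deg bs + c + 1)"
    by (simp only:)
  then have "shm_val F as m bs \<in> component N (deg as + fst m + deg bs + c + 1)"
    unfolding shm_val_def using assms(1) sg_mem graded_module_def by blast
  then show ?thesis
    by (simp add: homog_def shm_def)
qed

lemma dual_act_val_homog:
  assumes "ainf_module A M" "\<forall>x\<in>set as \<union> set bs. homog A x" "homog (dual M) \<phi>" "homog M m"
  shows "dual_act_val M as \<phi> bs (snd m) =
    - sg (deg as * (fst \<phi> + deg bs + fst m) + fst \<phi>) (snd \<phi> (shm_val (act M) bs m as))"
proof (cases "fst m = - (deg as + fst \<phi> + deg bs + 3)")
  case True
  show ?thesis
    unfolding dual_act_val_def Let_def True[symmetric] prod.collapse by (rule refl)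
next
  case False
  have gm: "graded_module M" and fam: "mod_family A M M 1 (act M)"
    using assms(1) by (auto simp: ainf_module_def)
  have lin: "module_hom (scal M) (*) (snd \<phi>)"
    and van: "\<And>d' x. d' \<noteq> - (fst \<phi> + 1) \<Longrightarrow> x \<in> component M d' \<Longrightarrow> snd \<phi> x = 0"
    using assms(3) by (auto simp: homog_def dual_def)
  have "homog M (shm 1 (act M) bs m as)"
    using homog_shm[OF gm fam] assms(2,4) by blast
  then have "shm_val (act M) bs m as \<in> component M (deg bs + fst m + deg as + 2)"
    by (simp add: homog_def shm_def algebra_simps)
  moreover have "deg bs + fst m + deg as + 2 \<noteq> - (fst \<phi> + 1)" using False by linarith
  ultimately have 0: "snd \<phi> (shm_val (act M) bs m as) = 0" using van by metis
  have neg: "snd \<phi> (- x) = - snd \<phi> x" for x using module_hom.neg[OF lin] .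
  have "snd \<phi> (act M (map snd bs) (snd m) (map snd as)) = 0"
    using 0 by (simp add: shm_val_def sg_def neg split: if_splits)
  then have "snd \<phi> (shm_val (act M) bs (dm, snd m) as) = 0" for dm
    by (simp add: shm_val_def sg_def neg)
  then show ?thesis using 0 by (simp add: dual_act_val_def Let_def sg_def)
qed

definition ainf_inner_product ::
  "('r::comm_ring_1, 'a::ab_group_add) ainf_alg \<Rightarrow> ('r, 'a, 'm::ab_group_add) ainf_mod \<Rightarrow>
   int \<Rightarrow> ('a list \<Rightarrow> 'm \<Rightarrow> 'a list \<Rightarrow> 'm \<Rightarrow> 'r) \<Rightarrow> bool" where
  "ainf_inner_product A M c I \<longleftrightarrow>
     module_morphism A M (dual M) (dual_act_val M) id_morphism c I"

definition exact_family ::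
  "('r::comm_ring_1, 'a::ab_group_add) ainf_alg \<Rightarrow> ('r, 'a, 'm::ab_group_add) ainf_mod \<Rightarrow>
   ('a list \<Rightarrow> 'm \<Rightarrow> 'a list \<Rightarrow> 'm \<Rightarrow> 'r) \<Rightarrow> bool" where
  "exact_family A M I \<longleftrightarrow>
     (\<exists>c G. mod_family A M (dual M) c G \<and>
       (\<forall>as m bs. (\<forall>x\<in>set as \<union> set bs. homog A x) \<and> homog M m \<longrightarrow>
          shm_val I as m bs = delta A M (dual_act_val M) c G as m bs))"

text \<open>The pulled back inner product on shifted homogeneous elements, for \<open>F\<close> of degree \<open>c\<close>.  Here
  \<open>a0\<close> consists of the first \<open>k - p\<close> algebra elements and \<open>b2\<close> of the last \<open>l - q\<close> ones.  The Koszul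
  sign has three contributions: \<open>a0\<close> moves to the end, the inner \<open>F\<close> moves past the arguments \<open>u\<close>
  of the maps \<open>f\<close> to its left, and the outer \<open>F\<close> moves past all arguments of the
  composite with \<open>J\<close>.\<close>

definition pullback_val ::
  "('a list \<Rightarrow> 'b::ab_group_add) \<Rightarrow> int \<Rightarrow> ('a list \<Rightarrow> 'm \<Rightarrow> 'a list \<Rightarrow> 'n::ab_group_add) \<Rightarrow>
   ('b list \<Rightarrow> 'n \<Rightarrow> 'b list \<Rightarrow> 'n \<Rightarrow> 'r::comm_ring_1) \<Rightarrow>
   'a tagged list \<Rightarrow> 'm tagged \<Rightarrow> 'a tagged list \<Rightarrow> 'm tagged \<Rightarrow> 'r" where
  "pullback_val f c F J as m bs m' =
     (\<Sum>(a0, u, a')\<in>splits3 as. \<Sum>us\<in>cuts u. \<Sum>(b', w, b2)\<in>splits3 bs. \<Sum>ws\<in>cuts w.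
        sg (deg a0 * (deg u + deg a' + fst m + deg bs + fst m')
            + c * deg u
            + c * (deg u + deg a' + fst m + deg b' + deg w))
          (shm_val J (map (sh 0 f) us) (shm c F a' m b') (map (sh 0 f) ws) (shm_val F b2 m' a0)))"

definition ainf_triple ::
  "('r::comm_ring_1, 'a::ab_group_add) ainf_alg \<Rightarrow> ('r, 'a, 'm::ab_group_add) ainf_mod \<Rightarrow>
   int \<Rightarrow> ('a list \<Rightarrow> 'm \<Rightarrow> 'a list \<Rightarrow> 'm \<Rightarrow> 'r) \<Rightarrow> bool" where
  "ainf_triple A M c I \<longleftrightarrow> ainf_algebra A \<and> ainf_module A M \<and> ainf_inner_product A M c I"

text \<open>In the following, \<open>K\<close> is the difference of the pullback of \<open>J\<close> and \<open>I\<close>; it is determined by its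
  values on homogeneous elements.\<close>

definition triple_morphism ::
  "('r::comm_ring_1, 'a::ab_group_add) ainf_alg \<Rightarrow> ('r, 'a, 'm::ab_group_add) ainf_mod \<Rightarrow>
   ('a list \<Rightarrow> 'm \<Rightarrow> 'a list \<Rightarrow> 'm \<Rightarrow> 'r) \<Rightarrow>
   ('r, 'b::ab_group_add) ainf_alg \<Rightarrow> ('r, 'b, 'n::ab_group_add) ainf_mod \<Rightarrow>
   ('b list \<Rightarrow> 'n \<Rightarrow> 'b list \<Rightarrow> 'n \<Rightarrow> 'r) \<Rightarrow>
   ('a list \<Rightarrow> 'b) \<Rightarrow> int \<Rightarrow> ('a list \<Rightarrow> 'm \<Rightarrow> 'a list \<Rightarrow> 'n) \<Rightarrow> bool" where
  "triple_morphism A M I B N J f c F \<longleftrightarrow>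
     ainf_morphism A B f \<and>
     module_morphism A M N (shm_val (act N)) f c F \<and>
     (\<exists>d K. ainf_inner_product A M d K \<and> exact_family A M K \<and>
       (\<forall>as m bs m'. (\<forall>x\<in>set as \<union> set bs. homog A x) \<and> homog M m \<and> homog M m' \<longrightarrow>
          shm_val K as m bs (snd m') =
          pullback_val f c F J as m bs m' - shm_val I as m bs (snd m')))"

subsection \<open>Cyclic defining systems and Massey inner products\<close>

text \<open>Both orders on the labels are given as lists, and intervals are nonempty segments of these lists.
  In the first order the label of the module element is \<open>k + 1\<close>, in the second one it is
  \<open>k + l + 2\<close>.\<close>

definition order1 :: "nat \<Rightarrow> nat \<Rightarrow> nat list" where
  "order1 k l = [1..<k + l + 2]"

definition order2 :: "nat \<Rightarrow> nat \<Rightarrow> nat list" where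
  "order2 k l = [k + 2..<k + l + 3] @ [1..<k + 1]"

definition intervals :: "nat list \<Rightarrow> nat list set" where
  "intervals L = {v. v \<noteq> [] \<and> (\<exists>u w. L = u @ v @ w)}"

definition sdeg :: "(nat \<Rightarrow> int) \<Rightarrow> nat list \<Rightarrow> int" where
  "sdeg e v = (\<Sum>i\<leftarrow>v. e i - 1)"

text \<open>\<open>entry e x v\<close> is the shifted entry of the family \<open>x\<close> with indices the end points of the
  interval \<open>v\<close>, where \<open>e i\<close> is the unshifted degree of the \<open>i\<close>-th given element.\<close>

definition entry :: "(nat \<Rightarrow> int) \<Rightarrow> (nat \<Rightarrow> nat \<Rightarrow> 'x) \<Rightarrow> nat list \<Rightarrow> 'x tagged" where
  "entry e x v = (sdeg e v, x (hd v) (last v))"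

text \<open>A family \<open>(x\<^sub>i\<^sub>j)\<close> with entries partly in \<open>A\<close> and partly in \<open>M\<close> is given by two functions:
  \<open>xm i j\<close> is the entry if the interval from \<open>i\<close> to \<open>j\<close> contains the label \<open>c\<close> of the module element,
  and \<open>xa i j\<close> is the entry otherwise.  Other values of these functions are irrelevant.\<close>

definition triangular_family ::
  "('r, 'a) ainf_alg \<Rightarrow> ('r, 'a, 'm) ainf_mod \<Rightarrow> nat list \<Rightarrow> nat \<Rightarrow>
   (nat \<Rightarrow> int) \<Rightarrow> (nat \<Rightarrow> 'a) \<Rightarrow> (nat \<Rightarrow> 'm) \<Rightarrow>
   (nat \<Rightarrow> nat \<Rightarrow> 'a) \<Rightarrow> (nat \<Rightarrow> nat \<Rightarrow> 'm) \<Rightarrow> bool" where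
  "triangular_family A M L c e a m xa xm \<longleftrightarrow>
     (\<forall>i\<in>set L. if i = c then xm i i = m i else xa i i = a i) \<and>
     (\<forall>v\<in>intervals L. if c \<in> set v then homog M (entry e xm v) else homog A (entry e xa v))"

definition staircase_alg ::
  "('r, 'a::ab_group_add) ainf_alg \<Rightarrow> (nat \<Rightarrow> int) \<Rightarrow> (nat \<Rightarrow> nat \<Rightarrow> 'a) \<Rightarrow> nat list \<Rightarrow> 'a" where
  "staircase_alg A e xa v =
     (\<Sum>bss | bss \<in> cuts v \<and> length bss \<ge> 2. sh_val (mu A) (map (entry e xa) bss))"

definition staircase_mod ::
  "('r, 'a, 'm::ab_group_add) ainf_mod \<Rightarrow> nat \<Rightarrow> (nat \<Rightarrow> int) \<Rightarrow>
   (nat \<Rightarrow> nat \<Rightarrow> 'a) \<Rightarrow> (nat \<Rightarrow> nat \<Rightarrow> 'm) \<Rightarrow> nat list \<Rightarrow> 'm" where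
  "staircase_mod M c e xa xm v =
     (\<Sum>(pre, b, post) | (pre, b, post) \<in> mcuts c v \<and> (pre \<noteq> [] \<or> post \<noteq> []).
        shm_val (act M) (map (entry e xa) pre) (entry e xm b) (map (entry e xa) post))"

definition defining_family ::
  "('r, 'a::ab_group_add) ainf_alg \<Rightarrow> ('r, 'a, 'm::ab_group_add) ainf_mod \<Rightarrow> nat list \<Rightarrow> nat \<Rightarrow>
   (nat \<Rightarrow> int) \<Rightarrow> (nat \<Rightarrow> nat \<Rightarrow> 'a) \<Rightarrow> (nat \<Rightarrow> nat \<Rightarrow> 'm) \<Rightarrow> bool" where
  "defining_family A M L c e xa xm \<longleftrightarrow>
     (\<forall>v\<in>intervals L.
        if c \<in> set v then act M [] (xm (hd v) (last v)) [] = - staircase_mod M c e xa xm v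
        else mu A [xa (hd v) (last v)] = - staircase_alg A e xa v)"

definition cyclic_triangular_system ::
  "('r, 'a) ainf_alg \<Rightarrow> ('r, 'a, 'm) ainf_mod \<Rightarrow> nat \<Rightarrow> nat \<Rightarrow>
   (nat \<Rightarrow> int) \<Rightarrow> (nat \<Rightarrow> 'a) \<Rightarrow> (nat \<Rightarrow> 'm) \<Rightarrow>
   (nat \<Rightarrow> nat \<Rightarrow> 'a) \<Rightarrow> (nat \<Rightarrow> nat \<Rightarrow> 'm) \<Rightarrow>
   (nat \<Rightarrow> nat \<Rightarrow> 'a) \<Rightarrow> (nat \<Rightarrow> nat \<Rightarrow> 'm) \<Rightarrow> bool" where
  "cyclic_triangular_system A M k l e a m xa xm xa' xm' \<longleftrightarrow>
     triangular_family A M (order1 k l) (k + 1) e a m xa xm \<and>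
     triangular_family A M (order2 k l) (k + l + 2) e a m xa' xm' \<and>
     (\<forall>i j. 1 \<le> i \<and> i \<le> j \<and> j \<le> k \<longrightarrow> xa i j = xa' i j) \<and>
     (\<forall>i j. k + 2 \<le> i \<and> i \<le> j \<and> j \<le> k + l + 1 \<longrightarrow> xa i j = xa' i j)"

definition cyclic_defining_system ::
  "('r, 'a::ab_group_add) ainf_alg \<Rightarrow> ('r, 'a, 'm::ab_group_add) ainf_mod \<Rightarrow> nat \<Rightarrow> nat \<Rightarrow>
   (nat \<Rightarrow> int) \<Rightarrow> (nat \<Rightarrow> 'a) \<Rightarrow> (nat \<Rightarrow> 'm) \<Rightarrow>
   (nat \<Rightarrow> nat \<Rightarrow> 'a) \<Rightarrow> (nat \<Rightarrow> nat \<Rightarrow> 'm) \<Rightarrow>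
   (nat \<Rightarrow> nat \<Rightarrow> 'a) \<Rightarrow> (nat \<Rightarrow> nat \<Rightarrow> 'm) \<Rightarrow> bool" where
  "cyclic_defining_system A M k l e a m xa xm xa' xm' \<longleftrightarrow>
     cyclic_triangular_system A M k l e a m xa xm xa' xm' \<and>
     defining_family A M (order1 k l) (k + 1) e xa xm \<and>
     defining_family A M (order2 k l) (k + l + 2) e xa' xm'"

definition staircase_inner ::
  "('a list \<Rightarrow> 'm \<Rightarrow> 'a list \<Rightarrow> 'm \<Rightarrow> 'r::comm_ring_1) \<Rightarrow> nat \<Rightarrow> nat \<Rightarrow> (nat \<Rightarrow> int) \<Rightarrow>
   (nat \<Rightarrow> nat \<Rightarrow> 'a) \<Rightarrow> (nat \<Rightarrow> nat \<Rightarrow> 'm) \<Rightarrow> (nat \<Rightarrow> nat \<Rightarrow> 'm) \<Rightarrow> 'r" where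
  "staircase_inner I k l e xa xm xm' =
     (\<Sum>p\<in>{1..k + 1}. \<Sum>q\<in>{k + 1..k + l + 1}. \<Sum>(pre, b, post)\<in>mcuts (k + 1) [p..<q + 1].
        sg (sdeg e [1..<p] * sdeg e [p..<k + l + 3])
          (shm_val I (map (entry e xa) pre) (entry e xm b) (map (entry e xa) post)
             (xm' (q + 1) (if p = 1 then k + l + 2 else p - 1))))"

text \<open>The given elements are \<open>a i\<close> for \<open>i\<close> in \<open>{1..k} \<union> {k + 2..k + l + 1}\<close> and \<open>m i\<close> for \<open>i\<close> in
  \<open>{k + 1, k + l + 2}\<close>, of degrees \<open>e i\<close>.\<close>

definition massey_inner ::
  "('r::comm_ring_1, 'a::ab_group_add) ainf_alg \<Rightarrow> ('r, 'a, 'm::ab_group_add) ainf_mod \<Rightarrow>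
   ('a list \<Rightarrow> 'm \<Rightarrow> 'a list \<Rightarrow> 'm \<Rightarrow> 'r) \<Rightarrow> nat \<Rightarrow> nat \<Rightarrow>
   (nat \<Rightarrow> int) \<Rightarrow> (nat \<Rightarrow> 'a) \<Rightarrow> (nat \<Rightarrow> 'm) \<Rightarrow> 'r set" where
  "massey_inner A M I k l e a m =
     {staircase_inner I k l e xa xm xm' | xa xm xa' xm'.
        cyclic_defining_system A M k l e a m xa xm xa' xm'}"

end

theory Submission
  imports Defs "HOL-Library.Sublist"
begin

text \<open>A defining system is an upper triangular Maurer--Cartan element: for every interval the sum of
  all structure maps over all cuts of the interval vanishes.  A morphism sends it to the system whose
  entry at an interval is the sum of the components of the morphism over all cuts of that interval, and
  the morphism equation turns the Maurer--Cartan equations of the source into those of the image.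
  Expanding the staircase inner product of \<open>J\<close> on the image system by multilinearity and regrouping the
  cuts gives the staircase inner product of the pullback of \<open>J\<close> on the original system.  This differs
  from that of \<open>I\<close> by the one of some \<open>\<delta>(G)\<close>, which vanishes: in each of its terms the argument of \<open>G\<close>
  or the one at which the value of \<open>G\<close> is evaluated is a Maurer--Cartan sum.\<close>

subsection \<open>Sums over decompositions of words\<close>

text \<open>Entries indexed by end points of intervals would make every regrouping of cuts a
  bijection between awkward index sets. The proof therefore indexes entries by words, and an
  interval containing the module label by the pair of words to its left and right. All sums become
  nested sums over splittings and cuts of words, governed by a few exchange laws; end points matter
  only in the translation to and from words.

  Two features shape the statements. Koszul signs depend on degree tags, so maps are additive only
  at a fixed tag, and each expansion has to check that its summands share one tag. The value of a
  family in the dual is known to be a linear form only at homogeneous arguments, so homogeneity of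
  the entries is carried along with the Maurer--Cartan equations. The degree of the module label is
  kept apart from the weights of the algebra labels because a morphism shifts only the
  former.\<close>

definition split_sum :: "'x list \<Rightarrow> ('x list \<Rightarrow> 'x list \<Rightarrow> 'c::ab_group_add) \<Rightarrow> 'c" where
  "split_sum xs h = (\<Sum>(u, v)\<in>splits2 xs. h u v)"

definition cut_sum :: "'x list \<Rightarrow> ('x list list \<Rightarrow> 'c::ab_group_add) \<Rightarrow> 'c" where
  "cut_sum xs h = (\<Sum>bss\<in>cuts xs. h bss)"

definition inner_sum ::
  "'x list \<Rightarrow> ('x list \<Rightarrow> 'x list \<Rightarrow> 'x list \<Rightarrow> 'c::ab_group_add) \<Rightarrow> 'c" where
  "inner_sum xs h = (\<Sum>(u, v, w)\<in>inner_splits xs. h u v w)"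

lemma split_sum_cong:
  "(\<And>u v. u @ v = xs \<Longrightarrow> h u v = h' u v) \<Longrightarrow> split_sum xs h = split_sum xs h'"
  unfolding split_sum_def by (rule sum.cong) (auto simp: splits2_def)

lemma cut_sum_cong:
  "(\<And>bss. concat bss = xs \<Longrightarrow> [] \<notin> set bss \<Longrightarrow> h bss = h' bss) \<Longrightarrow> cut_sum xs h = cut_sum xs h'"
  unfolding cut_sum_def by (rule sum.cong) (auto simp: cuts_def)

lemma split_sum_Nil [simp]: "split_sum [] h = h [] []"
  by (simp add: split_sum_def splits2_def)

lemma split_sum_Cons: "split_sum (x # xs) h = h [] (x # xs) + split_sum xs (\<lambda>u v. h (x # u) v)"
proof -
  have "splits2 (x # xs) = insert ([], x # xs) ((\<lambda>(u, v). (x # u, v)) ` splits2 xs)"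
    by (fastforce simp: splits2_def append_eq_Cons_conv)
  moreover have "inj_on (\<lambda>(u, v). (x # u, v)) (splits2 xs)"
    by (auto simp: inj_on_def)
  ultimately show ?thesis
    by (simp add: split_sum_def sum.reindex finite_splits2 case_prod_unfold image_iff)
qed

lemma concat_eq_NilD: "concat bss = [] \<Longrightarrow> [] \<notin> set bss \<Longrightarrow> bss = []"
  by (cases bss) auto

lemma cut_sum_Nil [simp]: "cut_sum ([] :: 'x list) h = h []"
proof -
  have "cuts [] = {[] :: 'x list list}"
  proof (intro equalityI subsetI)
    fix b :: "'x list list" assume "b \<in> cuts []"
    then show "b \<in> {[]}" by (cases b) (auto simp: cuts_def)
  qed (auto simp: cuts_def)
  then show ?thesis by (simp add: cut_sum_def)
qed

text \<open>The first block is nonempty and starts with \<open>x\<close>; choosing the rest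
  \<open>u\<close> of this block makes cuts accessible to induction on the length of the
  word.\<close>

lemma cut_sum_Cons:
  "cut_sum (x # xs) h = split_sum xs (\<lambda>u v. cut_sum v (\<lambda>bss. h ((x # u) # bss)))"
proof -
  let ?g = "\<lambda>((u, v), bss). (x # u) # bss"
  let ?S = "SIGMA t:splits2 xs. cuts (snd t)"
  have "cuts (x # xs) = ?g ` ?S"
  proof (intro equalityI subsetI)
    fix b assume "b \<in> cuts (x # xs)"
    then have b: "concat b = x # xs" "[] \<notin> set b" by (auto simp: cuts_def)
    then obtain b1 bs where b1: "b = b1 # bs" by (cases b) auto
    then obtain u where u: "b1 = x # u" using b by (cases b1) auto
    have "((u, concat bs), bs) \<in> ?S" using b b1 u by (auto simp: splits2_def cuts_def)
    then show "b \<in> ?g ` ?S" using b1 u by force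
  qed (auto simp: splits2_def cuts_def)
  moreover have "inj_on ?g ?S"
    by (auto simp: inj_on_def splits2_def cuts_def)
  ultimately have "cut_sum (x # xs) h = (\<Sum>t\<in>?S. h (?g t))"
    by (simp add: cut_sum_def sum.reindex)
  also have "\<dots> = (\<Sum>t\<in>splits2 xs. \<Sum>bss\<in>cuts (snd t). h (?g (t, bss)))"
    by (subst sum.Sigma) (auto simp: finite_splits2 finite_cuts case_prod_unfold)
  finally show ?thesis
    by (simp add: split_sum_def cut_sum_def case_prod_unfold)
qed

lemma split_sum_add: "split_sum xs (\<lambda>u v. h u v + h' u v) = split_sum xs h + split_sum xs h'"
  by (simp add: split_sum_def case_prod_unfold sum.distrib)

lemma cut_sum_add: "cut_sum xs (\<lambda>b. h b + h' b) = cut_sum xs h + cut_sum xs h'"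
  by (simp add: cut_sum_def sum.distrib)

lemma split_sum_zero [simp]: "split_sum xs (\<lambda>u v. 0) = 0"
  by (simp add: split_sum_def)

lemma cut_sum_zero [simp]: "cut_sum xs (\<lambda>b. 0) = 0"
  by (simp add: cut_sum_def)

lemma split_sum_additive: "additive g \<Longrightarrow> g (split_sum xs h) = split_sum xs (\<lambda>u v. g (h u v))"
  by (simp add: split_sum_def additive.sum case_prod_unfold)

lemma cut_sum_additive: "additive g \<Longrightarrow> g (cut_sum xs h) = cut_sum xs (\<lambda>b. g (h b))"
  by (simp add: cut_sum_def additive.sum)

lemma split_sum_swap:
  "split_sum xs (\<lambda>u v. split_sum ys (\<lambda>p q. h u v p q)) =
   split_sum ys (\<lambda>p q. split_sum xs (\<lambda>u v. h u v p q))"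
  unfolding split_sum_def case_prod_unfold by (rule sum.swap)

lemma cut_sum_swap:
  "cut_sum xs (\<lambda>b. cut_sum ys (\<lambda>c. h b c)) = cut_sum ys (\<lambda>c. cut_sum xs (\<lambda>b. h b c))"
  unfolding cut_sum_def by (rule sum.swap)

lemma cut_split_sum_swap:
  "cut_sum xs (\<lambda>b. split_sum ys (\<lambda>p q. h b p q)) = split_sum ys (\<lambda>p q. cut_sum xs (\<lambda>b. h b p q))"
  unfolding cut_sum_def split_sum_def case_prod_unfold by (rule sum.swap)

lemma split_sum_assoc:
  "split_sum xs (\<lambda>u v. split_sum u (\<lambda>p q. h p q v)) = split_sum xs (\<lambda>p r. split_sum r (\<lambda>q v. h p q v))"
proof (induction xs arbitrary: h)
  case (Cons x xs)
  then show ?case by (simp add: split_sum_Cons split_sum_add add.assoc)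
qed simp

text \<open>Splitting a list of blocks picks a position of the word at a block boundary, so the
  position may as well be chosen before both parts are cut. The induction removes the first
  block.\<close>

lemma cut_sum_split_sum:
  "cut_sum xs (\<lambda>css. split_sum css h) = split_sum xs (\<lambda>u v. cut_sum u (\<lambda>p. cut_sum v (\<lambda>q. h p q)))"
proof (induction xs arbitrary: h rule: length_induct)
  case (1 xs)
  show ?case
  proof (cases xs)
    case (Cons x ys)
    have "cut_sum xs (\<lambda>css. split_sum css h) = cut_sum xs (h []) +
        split_sum ys (\<lambda>u v. cut_sum v (\<lambda>bss. split_sum bss (\<lambda>p q. h ((x # u) # p) q)))"
      by (simp add: Cons cut_sum_Cons split_sum_Cons split_sum_add cut_sum_add)
    also have "split_sum ys (\<lambda>u v. cut_sum v (\<lambda>bss. split_sum bss (\<lambda>p q. h ((x # u) # p) q))) =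
        split_sum ys (\<lambda>u v. split_sum v (\<lambda>v1 v2. cut_sum v1 (\<lambda>p. cut_sum v2 (\<lambda>q. h ((x # u) # p) q))))"
      using 1 Cons by (intro split_sum_cong) auto
    also have "\<dots> = split_sum ys (\<lambda>s t. cut_sum (x # s) (\<lambda>p. cut_sum t (\<lambda>q. h p q)))"
      by (simp add: split_sum_assoc cut_sum_Cons)
    finally show ?thesis by (simp add: Cons split_sum_Cons)
  qed simp
qed

lemma split_sum_map: "split_sum (map f xs) h = split_sum xs (\<lambda>u v. h (map f u) (map f v))"
  by (induction xs arbitrary: h) (auto simp: split_sum_Cons)

lemma cut_sum_map: "cut_sum (map f xs) h = cut_sum xs (\<lambda>bss. h (map (map f) bss))"
proof (induction xs arbitrary: h rule: length_induct)
  case (1 xs)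
  show ?case
  proof (cases xs)
    case (Cons x ys)
    show ?thesis using 1 Cons
      by (auto simp: cut_sum_Cons split_sum_map intro!: split_sum_cong)
  qed simp
qed

text \<open>A zero summand in place of the condition on the middle word turns insertions into
  iterated splittings, to which the exchange laws apply.\<close>

lemma inner_sum_split_sum:
  "inner_sum xs h = split_sum xs (\<lambda>u r. split_sum r (\<lambda>v w. if v = [] then 0 else h u v w))"
proof -
  let ?S = "SIGMA t:splits2 xs. splits2 (snd t)"
  let ?h = "\<lambda>t. (fst (fst t), fst (snd t), snd (snd t))"
  have "split_sum xs (\<lambda>u r. split_sum r (\<lambda>v w. if v = [] then 0 else h u v w)) =
      (\<Sum>((u, r), (v, w))\<in>?S. if v = [] then 0 else h u v w)"
    unfolding split_sum_def case_prod_unfold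
    by (subst sum.Sigma) (auto simp: finite_splits2 case_prod_unfold)
  also have "\<dots> = (\<Sum>((u, r), (v, w))\<in>{t\<in>?S. fst (snd t) \<noteq> []}. h u v w)"
    by (intro sum.mono_neutral_cong_right) (auto intro!: finite_SigmaI simp: finite_splits2)
  also have "\<dots> = inner_sum xs h"
    unfolding inner_sum_def
    by (rule sum.reindex_bij_witness[where i = "\<lambda>(u, v, w). ((u, v @ w), (v, w))" and j = ?h])
      (auto simp: inner_splits_def splits2_def)
  finally show ?thesis by simp
qed

lemma splits3_split_sum:
  "(\<Sum>(u, v, w)\<in>splits3 xs. h u v w) = split_sum xs (\<lambda>u r. split_sum r (\<lambda>v w. h u v w))"
proof -
  let ?S = "SIGMA t:splits2 xs. splits2 (snd t)"
  let ?h = "\<lambda>t. (fst (fst t), fst (snd t), snd (snd t))"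
  have "split_sum xs (\<lambda>u r. split_sum r (\<lambda>v w. h u v w)) = (\<Sum>((u, r), (v, w))\<in>?S. h u v w)"
    unfolding split_sum_def case_prod_unfold
    by (subst sum.Sigma) (auto simp: finite_splits2 case_prod_unfold)
  also have "\<dots> = (\<Sum>(u, v, w)\<in>splits3 xs. h u v w)"
    by (rule sum.reindex_bij_witness[where i = "\<lambda>(u, v, w). ((u, v @ w), (v, w))" and j = ?h])
      (auto simp: splits3_def splits2_def)
  finally show ?thesis by simp
qed

lemma inner_sum_cong:
  "(\<And>u v w. u @ v @ w = xs \<Longrightarrow> v \<noteq> [] \<Longrightarrow> h u v w = h' u v w) \<Longrightarrow> inner_sum xs h = inner_sum xs h'"
  unfolding inner_sum_def by (rule sum.cong) (auto simp: inner_splits_def)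

lemma inner_sum_zero [simp]: "inner_sum xs (\<lambda>u v w. 0) = 0"
  by (simp add: inner_sum_def)

lemma inner_sum_map:
  "inner_sum (map f xs) h = inner_sum xs (\<lambda>u v w. h (map f u) (map f v) (map f w))"
  unfolding inner_sum_split_sum split_sum_map by simp

text \<open>Blocks are nonempty, so the inserted list of blocks is empty exactly when the inserted
  word is. The cuts of the inserted word are summed innermost because the Maurer--Cartan equation is
  applied there.\<close>

lemma cut_sum_inner_sum:
  "cut_sum xs (\<lambda>css. inner_sum css h) =
   inner_sum xs (\<lambda>u v w. cut_sum u (\<lambda>p. cut_sum w (\<lambda>r. cut_sum v (\<lambda>q. h p q r))))"
proof -
  have "cut_sum r (\<lambda>css. split_sum css (\<lambda>v w. if v = [] then 0 else h p v w)) =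
      split_sum r (\<lambda>v w. cut_sum v (\<lambda>q. cut_sum w (\<lambda>r. if v = [] then 0 else h p q r)))" for r p
    unfolding cut_sum_split_sum
    by (intro split_sum_cong cut_sum_cong) (auto dest: concat_eq_NilD simp del: concat_eq_Nil_conv)
  then have "cut_sum xs (\<lambda>css. inner_sum css h) = split_sum xs (\<lambda>u r. cut_sum u (\<lambda>p.
      split_sum r (\<lambda>v w. cut_sum v (\<lambda>q. cut_sum w (\<lambda>r. if v = [] then 0 else h p q r)))))"
    unfolding inner_sum_split_sum by (simp add: cut_sum_split_sum)
  also have "\<dots> = inner_sum xs (\<lambda>u v w. cut_sum u (\<lambda>p. cut_sum v (\<lambda>q. cut_sum w (\<lambda>r. h p q r))))"
    unfolding inner_sum_split_sum cut_split_sum_swap by (intro split_sum_cong) auto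
  finally show ?thesis by (subst cut_sum_swap)
qed

text \<open>The sum over all cuts of a word \<open>P c Q\<close> with one marked letter \<open>c\<close>: the block \<open>p' c q'\<close> containing
  the mark has the entry \<open>\<xi> p' q'\<close>, so that \<open>c\<close> itself need not be mentioned.\<close>

definition marked_sum ::
  "('x list \<Rightarrow> 'y) \<Rightarrow> ('x list \<Rightarrow> 'x list \<Rightarrow> 'z) \<Rightarrow> ('y list \<Rightarrow> 'z \<Rightarrow> 'y list \<Rightarrow> 'c::ab_group_add) \<Rightarrow>
   'x list \<Rightarrow> 'x list \<Rightarrow> 'c" where
  "marked_sum \<alpha> \<xi> H P Q =
     split_sum P (\<lambda>p p'. split_sum Q (\<lambda>q' q. cut_sum p (\<lambda>ps. cut_sum q (\<lambda>qs.
       H (map \<alpha> ps) (\<xi> p' q') (map \<alpha> qs)))))"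

lemma marked_sum_cong:
  assumes "\<And>p p' q' q ps qs. p @ p' = P \<Longrightarrow> q' @ q = Q \<Longrightarrow> concat ps = p \<Longrightarrow> [] \<notin> set ps \<Longrightarrow>
    concat qs = q \<Longrightarrow> [] \<notin> set qs \<Longrightarrow>
    H (map \<alpha> ps) (\<xi> p' q') (map \<alpha> qs) = H' (map \<alpha> ps) (\<xi> p' q') (map \<alpha> qs)"
  shows "marked_sum \<alpha> \<xi> H P Q = marked_sum \<alpha> \<xi> H' P Q"
  unfolding marked_sum_def using assms by (intro split_sum_cong cut_sum_cong)

lemma marked_sum_add:
  "marked_sum \<alpha> \<xi> (\<lambda>as m bs. H as m bs + H' as m bs) P Q = marked_sum \<alpha> \<xi> H P Q + marked_sum \<alpha> \<xi> H' P Q"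
  by (simp add: marked_sum_def split_sum_add cut_sum_add)

lemma marked_sum_additive:
  "additive g \<Longrightarrow> g (marked_sum \<alpha> \<xi> H P Q) = marked_sum \<alpha> \<xi> (\<lambda>as m bs. g (H as m bs)) P Q"
  by (simp add: marked_sum_def split_sum_additive cut_sum_additive)

text \<open>The combinatorics of one operation applied to the value of another at the marked
  argument: the inner operation sees a smaller interval around the mark, the outer one the cuts of
  what remains on both sides. The proof moves the splittings from lists of blocks to words.\<close>

lemma marked_sum_assoc:
  fixes \<xi> :: "'x list \<Rightarrow> 'x list \<Rightarrow> 'z" and H :: "_ \<Rightarrow> _ \<Rightarrow> _ \<Rightarrow> _ \<Rightarrow> _ \<Rightarrow> 'c::ab_group_add"
  shows "marked_sum \<alpha> \<xi> (\<lambda>as m bs. split_sum as (\<lambda>u u'. split_sum bs (\<lambda>w' w. H u u' m w' w))) P Q =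
   split_sum P (\<lambda>p p'. split_sum Q (\<lambda>q' q. cut_sum p (\<lambda>ps. cut_sum q (\<lambda>qs.
     marked_sum \<alpha> \<xi> (\<lambda>as m bs. H (map \<alpha> ps) as m bs (map \<alpha> qs)) p' q'))))" (is "?L = ?R")
proof -
  let ?h = "\<lambda>p' q' us us' ws' ws. H (map \<alpha> us) (map \<alpha> us') (\<xi> p' q') (map \<alpha> ws') (map \<alpha> ws)"
  have swap: "cut_sum u (\<lambda>us. cut_sum u' (\<lambda>us'. cut_sum w' (\<lambda>ws'. cut_sum w (\<lambda>ws. h us us' ws' ws)))) =
      cut_sum u (\<lambda>us. cut_sum w (\<lambda>ws. cut_sum u' (\<lambda>us'. cut_sum w' (\<lambda>ws'. h us us' ws' ws))))"
    for u u' w' w :: "'x list" and h :: "_ \<Rightarrow> _ \<Rightarrow> _ \<Rightarrow> _ \<Rightarrow> 'c"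
    by (subst cut_sum_swap[of w' w], subst cut_sum_swap[of u' w]) (rule refl)
  have "?L = split_sum P (\<lambda>p p'. split_sum Q (\<lambda>q' q. split_sum p (\<lambda>u u'. split_sum q (\<lambda>w' w.
      cut_sum u (\<lambda>us. cut_sum u' (\<lambda>us'. cut_sum w' (\<lambda>ws'. cut_sum w (\<lambda>ws.
        ?h p' q' us us' ws' ws))))))))"
    unfolding marked_sum_def split_sum_map cut_sum_split_sum cut_split_sum_swap ..
  also have "\<dots> = split_sum P (\<lambda>p p'. split_sum p (\<lambda>u u'. split_sum Q (\<lambda>q' q. split_sum q (\<lambda>w' w.
      cut_sum u (\<lambda>us. cut_sum u' (\<lambda>us'. cut_sum w' (\<lambda>ws'. cut_sum w (\<lambda>ws.
        ?h p' q' us us' ws' ws))))))))"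
    by (intro split_sum_cong split_sum_swap)
  also have "\<dots> = split_sum P (\<lambda>u r. split_sum r (\<lambda>u' p'. split_sum Q (\<lambda>s w. split_sum s (\<lambda>q' w'.
      cut_sum u (\<lambda>us. cut_sum u' (\<lambda>us'. cut_sum w' (\<lambda>ws'. cut_sum w (\<lambda>ws.
        ?h p' q' us us' ws' ws))))))))"
    unfolding split_sum_assoc ..
  also have "\<dots> = split_sum P (\<lambda>u r. split_sum Q (\<lambda>s w. split_sum r (\<lambda>u' p'. split_sum s (\<lambda>q' w'.
      cut_sum u (\<lambda>us. cut_sum u' (\<lambda>us'. cut_sum w' (\<lambda>ws'. cut_sum w (\<lambda>ws.
        ?h p' q' us us' ws' ws))))))))"
    by (intro split_sum_cong split_sum_swap)
  also have "\<dots> = ?R"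
    unfolding marked_sum_def cut_split_sum_swap by (intro split_sum_cong swap)
  finally show ?thesis .
qed

lemma cut_marked_sum_swap:
  "cut_sum xs (\<lambda>b. marked_sum \<alpha> \<xi> (H b) P Q) = marked_sum \<alpha> \<xi> (\<lambda>as m bs. cut_sum xs (\<lambda>b. H b as m bs)) P Q"
  unfolding marked_sum_def cut_split_sum_swap
  by (intro split_sum_cong) (simp add: cut_sum_swap[of xs])

subsection \<open>Multilinearity\<close>

lemma additive_sg: "additive (sg s)"
  by (auto simp: additive_def sg_def)

lemma sg_zero [simp]: "sg s 0 = 0"
  by (simp add: sg_def)

lemma sg_sg: "sg s (sg t x) = sg (s + t) x"
  by (auto simp: sg_def)

lemma sg_even: "even s \<Longrightarrow> sg s x = x"
  by (simp add: sg_def)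

lemma sg_cong: "even (s - t) \<Longrightarrow> sg s x = sg t x"
  by (auto simp: sg_def)

lemma additive_comp: "additive g \<Longrightarrow> additive h \<Longrightarrow> additive (\<lambda>x. g (h x))"
  by (simp add: additive_def)

lemma additive_module_hom: "module_hom s t g \<Longrightarrow> additive g"
  by (simp add: additive_def module_hom.add)

lemma deg_append [simp]: "deg (xs @ ys) = deg xs + deg ys"
  by (simp add: deg_def)

lemma deg_Nil [simp]: "deg [] = 0"
  by (simp add: deg_def)

lemma deg_Cons [simp]: "deg (x # xs) = fst x + deg xs"
  by (simp add: deg_def)

lemma sdeg_append [simp]: "sdeg e (xs @ ys) = sdeg e xs + sdeg e ys"
  by (simp add: sdeg_def)

lemma sdeg_Nil [simp]: "sdeg e [] = 0"
  by (simp add: sdeg_def)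

lemma sdeg_Cons [simp]: "sdeg e (x # xs) = e x - 1 + sdeg e xs"
  by (simp add: sdeg_def)

text \<open>The tag \<open>d\<close> is fixed because the signs of shifted maps depend on it.
  Additivity is enough, as only finite sums and signs are moved through the maps.\<close>

definition slot_additive :: "('a::ab_group_add tagged list \<Rightarrow> 'c::ab_group_add) \<Rightarrow> bool" where
  "slot_additive h \<longleftrightarrow> (\<forall>us d ws. additive (\<lambda>x. h (us @ (d, x) # ws)))"

definition marked_additive ::
  "('a::ab_group_add tagged list \<Rightarrow> 'm::ab_group_add tagged \<Rightarrow> 'a tagged list \<Rightarrow> 'c::ab_group_add) \<Rightarrow> bool"
where
  "marked_additive H \<longleftrightarrow>
     (\<forall>m bs. slot_additive (\<lambda>as. H as m bs)) \<and>
     (\<forall>as d bs. additive (\<lambda>x. H as (d, x) bs)) \<and>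
     (\<forall>as m. slot_additive (H as m))"

lemma slot_additiveD: "slot_additive h \<Longrightarrow> additive (\<lambda>x. h (us @ (d, x) # ws))"
  by (simp add: slot_additive_def)

lemma slot_additive_Cons: "slot_additive h \<Longrightarrow> slot_additive (\<lambda>ws. h (w # ws))"
  unfolding slot_additive_def append_Cons[symmetric] by blast

lemma slot_additive_sh_val: "alg_family A B c h \<Longrightarrow> slot_additive (sh_val h)"
  unfolding slot_additive_def sh_val_def map_append list.map fst_conv snd_conv
  by (intro allI additive_comp[OF additive_sg] additive_module_hom[of "scal A" "scal B"])
    (simp add: alg_family_def)

lemma marked_additive_shm_val: "mod_family A M N c F \<Longrightarrow> marked_additive (shm_val F)"
  unfolding marked_additive_def slot_additive_def shm_val_def map_append list.map fst_conv snd_conv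
  by (intro conjI allI additive_comp[OF additive_sg])
    (simp_all add: mod_family_def additive_module_hom[of "scal A" "scal N"]
      additive_module_hom[of "scal M" "scal N"])

text \<open>A coarse cut with a cut of each of its blocks is the same as a fine cut with a grouping
  of its blocks. The hypotheses are restricted to subwords of \<open>v\<close> because entries of a
  system are controlled only on intervals.\<close>

lemma cut_sum_image:
  assumes "slot_additive h"
    and "\<And>b c. b \<noteq> [] \<Longrightarrow> sublist b v \<Longrightarrow> concat c = b \<Longrightarrow> [] \<notin> set c \<Longrightarrow> fst (g c) = fst (\<phi> b)"
    and "\<And>b. b \<noteq> [] \<Longrightarrow> sublist b v \<Longrightarrow> snd (\<phi> b) = cut_sum b (\<lambda>c. snd (g c))"
  shows "cut_sum v (\<lambda>bss. h (map \<phi> bss)) = cut_sum v (\<lambda>css. cut_sum css (\<lambda>dss. h (map g dss)))"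
  using assms
proof (induction v arbitrary: h rule: length_induct)
  case (1 v)
  note IH = 1(1)[rule_format] and add = 1(2) and tag = 1(3) and val = 1(4)
  show ?case
  proof (cases v)
    case (Cons x ys)
    have "cut_sum w (\<lambda>bss. h (\<phi> (x # u) # map \<phi> bss)) =
        cut_sum (x # u) (\<lambda>c. cut_sum w (\<lambda>css. cut_sum css (\<lambda>dss. h (g c # map g dss))))"
      if uw: "u @ w = ys" for u w
    proof -
      have xu: "sublist (x # u) v" and w: "sublist w v"
        using Cons uw by (auto simp: sublist_def intro: exI[of _ "[]"] exI[of _ "x # u"])
      \<comment> \<open>The first block is expanded by additivity in the first slot; equality of
        tags lets the tag of \<open>\<phi> (x # u)\<close> be replaced by that of each
        summand.\<close>
      have "h (\<phi> (x # u) # ts) = cut_sum (x # u) (\<lambda>c. h (g c # ts))" for ts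
      proof -
        have "additive (\<lambda>y. h ((fst (\<phi> (x # u)), y) # ts))"
          using slot_additiveD[OF add, of "[]"] by simp
        from cut_sum_additive[OF this, of "x # u" "\<lambda>c. snd (g c)"] val[OF _ xu]
        have "h (\<phi> (x # u) # ts) = cut_sum (x # u) (\<lambda>c. h ((fst (\<phi> (x # u)), snd (g c)) # ts))"
          by (metis list.distinct(1) prod.collapse)
        also have "\<dots> = cut_sum (x # u) (\<lambda>c. h (g c # ts))"
          by (intro cut_sum_cong) (metis tag[OF _ xu] list.distinct(1) prod.collapse)
        finally show ?thesis .
      qed
      then have "cut_sum w (\<lambda>bss. h (\<phi> (x # u) # map \<phi> bss)) =
          cut_sum (x # u) (\<lambda>c. cut_sum w (\<lambda>bss. h (g c # map \<phi> bss)))"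
        by (simp add: cut_sum_swap[of w])
      also have "\<dots> = cut_sum (x # u) (\<lambda>c. cut_sum w (\<lambda>css. cut_sum css (\<lambda>dss. h (g c # map g dss))))"
        using w uw Cons
        by (intro cut_sum_cong IH slot_additive_Cons add tag val) (auto intro: sublist_order.order_trans)
      finally show ?thesis .
    qed
    then have "cut_sum v (\<lambda>bss. h (map \<phi> bss)) = split_sum ys (\<lambda>u w.
        cut_sum (x # u) (\<lambda>c. cut_sum w (\<lambda>css. cut_sum css (\<lambda>dss. h (g c # map g dss)))))"
      unfolding Cons cut_sum_Cons by (intro split_sum_cong) simp
    also have "\<dots> = split_sum ys (\<lambda>s w. split_sum s (\<lambda>u u'. cut_sum u' (\<lambda>bss. cut_sum w (\<lambda>css.
        cut_sum css (\<lambda>dss. h (g ((x # u) # bss) # map g dss))))))"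
      by (simp add: cut_sum_Cons)
    also have "\<dots> = split_sum ys (\<lambda>u r. cut_sum r (\<lambda>bs. split_sum bs (\<lambda>p q.
        cut_sum q (\<lambda>dss. h (g ((x # u) # p) # map g dss)))))"
      by (simp add: split_sum_assoc cut_sum_split_sum)
    also have "\<dots> = cut_sum v (\<lambda>css. cut_sum css (\<lambda>dss. h (map g dss)))"
      by (simp add: Cons cut_sum_Cons)
    finally show ?thesis .
  qed simp
qed

subsection \<open>Defining systems as Maurer--Cartan elements\<close>

text \<open>The equation \<open>d(x) = - S\<close> of a defining system says that the sum over all cuts vanishes, the cut
  into one block included.\<close>

definition alg_mc ::
  "('r, 'a::ab_group_add) ainf_alg \<Rightarrow> (nat \<Rightarrow> int) \<Rightarrow> (nat list \<Rightarrow> 'a tagged) \<Rightarrow> nat list \<Rightarrow> bool" where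
  "alg_mc A e \<alpha> L \<longleftrightarrow> (\<forall>b. b \<noteq> [] \<and> sublist b L \<longrightarrow>
     homog A (\<alpha> b) \<and> fst (\<alpha> b) = sdeg e b \<and> cut_sum b (\<lambda>bss. sh_val (mu A) (map \<alpha> bss)) = 0)"

lemma sublist_concat: "b \<in> set bss \<Longrightarrow> sublist b (concat bss)"
  by (metis concat.simps(2) concat_append in_set_conv_decomp sublist_appendI)

lemma alg_mc_blocks:
  assumes "alg_mc A e \<alpha> L" "sublist (concat ps) L" "[] \<notin> set ps"
  shows "deg (map \<alpha> ps) = sdeg e (concat ps)" and "\<forall>x\<in>set (map \<alpha> ps). homog A x"
proof -
  have b: "b \<noteq> []" "sublist b L" if "b \<in> set ps" for b
    using that assms(2,3) sublist_concat sublist_order.order_trans by blast+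
  then show "\<forall>x\<in>set (map \<alpha> ps). homog A x"
    using assms(1) by (auto simp: alg_mc_def)
  have "\<forall>b\<in>set ps. fst (\<alpha> b) = sdeg e b"
    using b assms(1) by (auto simp: alg_mc_def)
  then show "deg (map \<alpha> ps) = sdeg e (concat ps)"
    by (induction ps) auto
qed

text \<open>With the outer blocks fixed, the tag of the inserted value does not depend on the cut of
  the inserted word, so the sum over these cuts can be moved into the slot, where it is a
  Maurer--Cartan sum. The parameter \<open>s\<close> absorbs the degrees of arguments further to the
  left.\<close>

lemma alg_mc_inner_sum:
  assumes mc: "alg_mc A e \<alpha> L" and v: "sublist v L" and h: "slot_additive h"
  shows "cut_sum v (\<lambda>css. inner_sum (map \<alpha> css)
    (\<lambda>u v w. sg (s + deg u) (h (u @ sh 1 (mu A) v # w)))) = 0"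
proof -
  have "cut_sum q (\<lambda>qs. sg (s + deg u) (h (u @ sh 1 (mu A) (map \<alpha> qs) # w))) = 0"
    if q: "p @ q @ r = v" "q \<noteq> []" for p q r u w
  proof -
    have "sublist q L" using q(1) v by (metis sublist_appendI sublist_order.order_trans)
    then have deg: "cut_sum q (\<lambda>qs. sg (s + deg u) (h (u @ sh 1 (mu A) (map \<alpha> qs) # w))) =
        cut_sum q (\<lambda>qs. sg (s + deg u) (h (u @ (sdeg e q + 1, sh_val (mu A) (map \<alpha> qs)) # w)))"
      and z: "cut_sum q (\<lambda>qs. sh_val (mu A) (map \<alpha> qs)) = 0"
      using mc q(2) by (auto intro!: cut_sum_cong simp: sh_def alg_mc_blocks alg_mc_def)
    have add: "additive (\<lambda>x. sg (s + deg u) (h (u @ (sdeg e q + 1, x) # w)))"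
      by (intro additive_comp[OF additive_sg] slot_additiveD h)
    show ?thesis
      unfolding deg cut_sum_additive[OF add, symmetric] z by (rule additive.zero[OF add])
  qed
  then show ?thesis
    unfolding inner_sum_map cut_sum_inner_sum
    by (subst inner_sum_cong[where h' = "\<lambda>u v w. 0"]) auto
qed

text \<open>The weight \<open>z\<close> of the module label is separate from \<open>e\<close>, so
  that the image of a system under a morphism keeps \<open>e\<close> and changes only
  \<open>z\<close>. For the second order the roles of \<open>U\<close> and \<open>V\<close> are
  exchanged.\<close>

definition mod_mc ::
  "('r, 'a::ab_group_add) ainf_alg \<Rightarrow> ('r, 'a, 'm::ab_group_add) ainf_mod \<Rightarrow> (nat \<Rightarrow> int) \<Rightarrow>
   (nat list \<Rightarrow> 'a tagged) \<Rightarrow> (nat list \<Rightarrow> nat list \<Rightarrow> 'm tagged) \<Rightarrow> int \<Rightarrow> nat list \<Rightarrow> nat list \<Rightarrow> bool"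
where
  "mod_mc A M e \<alpha> \<xi> z U V \<longleftrightarrow> alg_mc A e \<alpha> U \<and> alg_mc A e \<alpha> V \<and>
     (\<forall>P Q. suffix P U \<and> prefix Q V \<longrightarrow> homog M (\<xi> P Q) \<and> fst (\<xi> P Q) = sdeg e P + z + sdeg e Q \<and>
       marked_sum \<alpha> \<xi> (shm_val (act M)) P Q = 0)"

lemma suffix_pieces: "suffix (p @ p') U \<Longrightarrow> sublist p U" "suffix (p @ p') U \<Longrightarrow> suffix p' U"
  by (auto simp: suffix_def sublist_def)

lemma prefix_pieces: "prefix (q' @ q) V \<Longrightarrow> sublist q V" "prefix (q' @ q) V \<Longrightarrow> prefix q' V"
  by (auto simp: prefix_def sublist_def)

lemma mod_mc_pieces:
  assumes "mod_mc A M e \<alpha> \<xi> z U V" "suffix (concat ps @ p') U" "prefix (q' @ concat qs) V"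
    "[] \<notin> set ps" "[] \<notin> set qs"
  shows "deg (map \<alpha> ps) = sdeg e (concat ps)" "deg (map \<alpha> qs) = sdeg e (concat qs)"
    "fst (\<xi> p' q') = sdeg e p' + z + sdeg e q'"
    "\<forall>x\<in>set (map \<alpha> ps) \<union> set (map \<alpha> qs). homog A x" "homog M (\<xi> p' q')"
    "suffix p' U" "prefix q' V" "sublist (concat ps) U" "sublist (concat qs) V"
proof -
  show s: "suffix p' U" "prefix q' V" "sublist (concat ps) U" "sublist (concat qs) V"
    using assms(2,3) suffix_pieces prefix_pieces by blast+
  show "deg (map \<alpha> ps) = sdeg e (concat ps)" "deg (map \<alpha> qs) = sdeg e (concat qs)"
    "\<forall>x\<in>set (map \<alpha> ps) \<union> set (map \<alpha> qs). homog A x"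
    using assms s alg_mc_blocks unfolding mod_mc_def by (metis Un_iff)+
  show "fst (\<xi> p' q') = sdeg e p' + z + sdeg e q'" "homog M (\<xi> p' q')"
    using assms(1) s by (auto simp: mod_mc_def)
qed

lemma mod_mc_pieces':
  assumes "mod_mc A M e \<alpha> \<xi> z U V" "suffix P U" "prefix Q V" "p @ p' = P" "q' @ q = Q"
    "concat ps = p" "concat qs = q" "[] \<notin> set ps" "[] \<notin> set qs"
  shows "deg (map \<alpha> ps) = sdeg e p" "deg (map \<alpha> qs) = sdeg e q"
    "fst (\<xi> p' q') = sdeg e p' + z + sdeg e q'"
    "\<forall>x\<in>set (map \<alpha> ps) \<union> set (map \<alpha> qs). homog A x" "homog M (\<xi> p' q')"
    "suffix p' U" "prefix q' V" "sublist p U" "sublist q V"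
  using mod_mc_pieces[of A M e \<alpha> \<xi> z U V ps p' q' qs] assms by auto

text \<open>Every summand has the same tag \<open>t\<close>, since the pieces of a marked cut
  exhaust \<open>P\<close> and \<open>Q\<close>; so additivity at this tag applies.\<close>

lemma marked_sum_shm:
  assumes mc: "mod_mc A M e \<alpha> \<xi> z U V" and PQ: "suffix P U" "prefix Q V"
    and t: "t = sdeg e P + z + sdeg e Q + c" and add: "additive (\<lambda>x. h (t, x))"
  shows "marked_sum \<alpha> \<xi> (\<lambda>as m bs. h (shm c F as m bs)) P Q = h (t, marked_sum \<alpha> \<xi> (shm_val F) P Q)"
proof -
  have "marked_sum \<alpha> \<xi> (\<lambda>as m bs. h (shm c F as m bs)) P Q =
      marked_sum \<alpha> \<xi> (\<lambda>as m bs. h (t, shm_val F as m bs)) P Q"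
    using mod_mc_pieces'[OF mc PQ] by (intro marked_sum_cong) (auto simp: shm_def t algebra_simps)
  then show ?thesis by (simp add: marked_sum_additive[OF add])
qed

lemma split_sum_eq_0: "(\<And>u v. u @ v = xs \<Longrightarrow> h u v = 0) \<Longrightarrow> split_sum xs h = 0"
  using split_sum_cong[of xs h "\<lambda>u v. 0"] by simp

lemma cut_sum_eq_0: "(\<And>b. concat b = xs \<Longrightarrow> [] \<notin> set b \<Longrightarrow> h b = 0) \<Longrightarrow> cut_sum xs h = 0"
  using cut_sum_cong[of xs h "\<lambda>b. 0"] by simp

text \<open>Each of the three parts of \<open>comp_act\<close> inserts a structure map into one
  argument of \<open>F\<close>. Summed over all cuts, this argument becomes a Maurer--Cartan sum,
  and \<open>F\<close> is additive in it.\<close>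

lemma marked_sum_comp_act:
  assumes mc: "mod_mc A M e \<alpha> \<xi> z U V" and PQ: "suffix P U" "prefix Q V"
    and F: "marked_additive (shm_val F)"
  shows "marked_sum \<alpha> \<xi> (comp_act A M F) P Q = 0"
proof -
  let ?T1 = "\<lambda>as m bs. inner_sum as (\<lambda>u v w. sg (deg u) (shm_val F (u @ sh 1 (mu A) v # w) m bs))"
  let ?T2 = "\<lambda>as m bs. split_sum as (\<lambda>u u'. split_sum bs (\<lambda>w' w.
    sg (deg u) (shm_val F u (shm 1 (act M) u' m w') w)))"
  let ?T3 = "\<lambda>as m bs. inner_sum bs (\<lambda>u v w.
    sg (deg as + fst m + deg u) (shm_val F as m (u @ sh 1 (mu A) v # w)))"
  have add: "\<And>m bs. slot_additive (\<lambda>as. shm_val F as m bs)"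
      "\<And>as d bs. additive (\<lambda>x. shm_val F as (d, x) bs)" "\<And>as m. slot_additive (shm_val F as m)"
    using F by (auto simp: marked_additive_def)
  have sub: "sublist p U" "sublist q V" "suffix p' U" "prefix q' V"
    if "p @ p' = P" "q' @ q = Q" for p p' q' q
    using that PQ suffix_pieces prefix_pieces by blast+
  have mcU: "alg_mc A e \<alpha> U" and mcV: "alg_mc A e \<alpha> V"
    using mc by (auto simp: mod_mc_def)
  have "marked_sum \<alpha> \<xi> ?T1 P Q = 0"
    unfolding marked_sum_def
    by (subst cut_sum_swap, intro split_sum_eq_0, rule cut_sum_eq_0)
      (use alg_mc_inner_sum[OF mcU _ add(1), where s = 0] sub in simp)
  moreover have "marked_sum \<alpha> \<xi> ?T3 P Q = 0"
    unfolding marked_sum_def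
    by (intro split_sum_eq_0, rule cut_sum_eq_0) (use alg_mc_inner_sum[OF mcV _ add(3)] sub in simp)
  moreover have "marked_sum \<alpha> \<xi> ?T2 P Q = 0"
  proof -
    \<comment> \<open>After \<open>marked_sum_assoc\<close> the inner action runs over all marked
      cuts of the smaller interval, so its sum is the equation of that interval.\<close>
    have "marked_sum \<alpha> \<xi> (\<lambda>as m bs. sg s (shm_val F u (shm 1 (act M) as m bs) w)) p' q' = 0"
      if "suffix p' U" "prefix q' V" for p' q' s u w
    proof -
      have ad: "additive (\<lambda>x. sg s (shm_val F u (sdeg e p' + z + sdeg e q' + 1, x) w))"
        by (intro additive_comp[OF additive_sg] add)
      have "marked_sum \<alpha> \<xi> (shm_val (act M)) p' q' = 0"
        using that mc by (auto simp: mod_mc_def)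
      then show ?thesis
        using marked_sum_shm[OF mc that refl, where c = 1 and h = "\<lambda>y. sg s (shm_val F u y w)" and F = "act M", OF ad]
        by (simp add: additive.zero[OF ad])
    qed
    then show ?thesis
      unfolding marked_sum_assoc by (auto intro!: split_sum_eq_0 cut_sum_eq_0 simp: sub)
  qed
  moreover have "comp_act A M F = (\<lambda>as m bs. ?T1 as m bs + ?T2 as m bs + ?T3 as m bs)"
    by (simp add: fun_eq_iff comp_act_def inner_sum_def split_sum_def)
  ultimately show ?thesis
    by (simp add: marked_sum_add)
qed

subsection \<open>Images of defining systems under morphisms\<close>

definition push_alg ::
  "(nat \<Rightarrow> int) \<Rightarrow> ('a list \<Rightarrow> 'b::ab_group_add) \<Rightarrow> (nat list \<Rightarrow> 'a tagged) \<Rightarrow> nat list \<Rightarrow> 'b tagged" where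
  "push_alg e f \<alpha> b = (sdeg e b, cut_sum b (\<lambda>css. sh_val f (map \<alpha> css)))"

text \<open>Here \<open>z\<close> is the degree of the image of the module label, hence the later
  instances \<open>z + c\<close>. The tag is written out because a sum of values carries no degree
  of its own.\<close>

definition push_mod ::
  "(nat \<Rightarrow> int) \<Rightarrow> int \<Rightarrow> ('a list \<Rightarrow> 'm \<Rightarrow> 'a list \<Rightarrow> 'n::ab_group_add) \<Rightarrow>
   (nat list \<Rightarrow> 'a tagged) \<Rightarrow> (nat list \<Rightarrow> nat list \<Rightarrow> 'm tagged) \<Rightarrow> nat list \<Rightarrow> nat list \<Rightarrow> 'n tagged" where
  "push_mod e z F \<alpha> \<xi> P Q = (sdeg e P + z + sdeg e Q, marked_sum \<alpha> \<xi> (shm_val F) P Q)"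

lemma cut_sum_push_alg:
  assumes "alg_mc A e \<alpha> L" "sublist v L" "slot_additive h"
  shows "cut_sum v (\<lambda>bss. h (map (push_alg e f \<alpha>) bss)) =
    cut_sum v (\<lambda>css. cut_sum (map \<alpha> css) (\<lambda>dss. h (map (sh 0 f) dss)))"
proof -
  have "cut_sum v (\<lambda>bss. h (map (push_alg e f \<alpha>) bss)) =
      cut_sum v (\<lambda>css. cut_sum css (\<lambda>dss. h (map (\<lambda>c. sh 0 f (map \<alpha> c)) dss)))"
    using alg_mc_blocks(1)[OF assms(1)] sublist_order.order_trans[OF _ assms(2)]
    by (intro cut_sum_image assms(3)) (auto simp: push_alg_def sh_def)
  then show ?thesis by (simp add: cut_sum_map comp_def)
qed

text \<open>The right-hand side is that of the morphism equation, without its signs and with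
  \<open>H\<close> in place of the structure maps of the target. Taking the action of the target for
  \<open>H\<close> yields the equations of the image, taking \<open>J\<close> the inner part of the
  pullback.\<close>

lemma marked_sum_push:
  assumes mc: "mod_mc A M e \<alpha> \<xi> z U V" and PQ: "suffix P U" "prefix Q V" and H: "marked_additive H"
  shows "marked_sum (push_alg e f \<alpha>) (push_mod e (z + c) F \<alpha> \<xi>) H P Q =
    marked_sum \<alpha> \<xi> (\<lambda>as m bs. split_sum as (\<lambda>u u'. split_sum bs (\<lambda>w' w. cut_sum u (\<lambda>us. cut_sum w (\<lambda>ws.
      H (map (sh 0 f) us) (shm c F u' m w') (map (sh 0 f) ws)))))) P Q"
proof -
  let ?g = "map (sh 0 f)" and ?\<phi> = "push_alg e f \<alpha>" and ?\<eta> = "push_mod e (z + c) F \<alpha> \<xi>"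
  have add: "\<And>m bs. slot_additive (\<lambda>as. H as m bs)"
      "\<And>as d bs. additive (\<lambda>x. H as (d, x) bs)" "\<And>as m. slot_additive (H as m)"
    using H by (auto simp: marked_additive_def)
  have "cut_sum p (\<lambda>ps. cut_sum q (\<lambda>qs. H (map ?\<phi> ps) (?\<eta> p' q') (map ?\<phi> qs))) =
      cut_sum p (\<lambda>ps. cut_sum q (\<lambda>qs. marked_sum \<alpha> \<xi> (\<lambda>as m bs.
        cut_sum (map \<alpha> ps) (\<lambda>us. cut_sum (map \<alpha> qs) (\<lambda>ws. H (?g us) (shm c F as m bs) (?g ws)))) p' q'))"
    (is "?l = ?r") if pq: "p @ p' = P" "q' @ q = Q" for p p' q' q
  proof -
    have sub: "sublist p U" "sublist q V" "suffix p' U" "prefix q' V"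
      using pq PQ suffix_pieces prefix_pieces by blast+
    have mcU: "alg_mc A e \<alpha> U" and mcV: "alg_mc A e \<alpha> V"
      using mc by (auto simp: mod_mc_def)
    \<comment> \<open>Additivity of \<open>H\<close> at the marked argument: the values of
      \<open>F\<close> add up to the image entry.\<close>
    have mid: "marked_sum \<alpha> \<xi> (\<lambda>as m bs. H us (shm c F as m bs) ws) p' q' = H us (?\<eta> p' q') ws" for us ws
      using marked_sum_shm[OF mc sub(3,4) refl, where c = c and h = "\<lambda>y. H us y ws" and F = F, OF add(2)]
      by (simp add: push_mod_def ac_simps)
    \<comment> \<open>The algebra entries right of the mark are expanded before those on the left;
      the exchanges bring the cuts to be expanded innermost.\<close>
    have "?l = cut_sum p (\<lambda>ps. cut_sum q (\<lambda>qs. cut_sum (map \<alpha> qs) (\<lambda>ws.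
        H (map ?\<phi> ps) (?\<eta> p' q') (?g ws))))"
      by (intro cut_sum_cong cut_sum_push_alg[OF mcV sub(2) add(3)])
    also have "\<dots> = cut_sum q (\<lambda>qs. cut_sum p (\<lambda>ps. cut_sum (map \<alpha> qs) (\<lambda>ws.
        H (map ?\<phi> ps) (?\<eta> p' q') (?g ws))))"
      by (rule cut_sum_swap)
    also have "\<dots> = cut_sum q (\<lambda>qs. cut_sum (map \<alpha> qs) (\<lambda>ws. cut_sum p (\<lambda>ps.
        H (map ?\<phi> ps) (?\<eta> p' q') (?g ws))))"
      by (intro cut_sum_cong cut_sum_swap)
    also have "\<dots> = cut_sum q (\<lambda>qs. cut_sum (map \<alpha> qs) (\<lambda>ws. cut_sum p (\<lambda>ps. cut_sum (map \<alpha> ps) (\<lambda>us.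
        H (?g us) (?\<eta> p' q') (?g ws)))))"
      by (intro cut_sum_cong cut_sum_push_alg[OF mcU sub(1) add(1)])
    also have "\<dots> = cut_sum q (\<lambda>qs. cut_sum p (\<lambda>ps. cut_sum (map \<alpha> qs) (\<lambda>ws. cut_sum (map \<alpha> ps) (\<lambda>us.
        H (?g us) (?\<eta> p' q') (?g ws)))))"
      by (intro cut_sum_cong cut_sum_swap)
    also have "\<dots> = cut_sum p (\<lambda>ps. cut_sum q (\<lambda>qs. cut_sum (map \<alpha> qs) (\<lambda>ws. cut_sum (map \<alpha> ps) (\<lambda>us.
        H (?g us) (?\<eta> p' q') (?g ws)))))"
      by (rule cut_sum_swap)
    also have "\<dots> = cut_sum p (\<lambda>ps. cut_sum q (\<lambda>qs. cut_sum (map \<alpha> ps) (\<lambda>us. cut_sum (map \<alpha> qs) (\<lambda>ws.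
        H (?g us) (?\<eta> p' q') (?g ws)))))"
      by (intro cut_sum_cong cut_sum_swap)
    also have "\<dots> = ?r"
      by (simp only: cut_marked_sum_swap[symmetric] mid)
    finally show ?thesis .
  qed
  then show ?thesis
    unfolding marked_sum_assoc unfolding marked_sum_def[of ?\<phi>] by (intro split_sum_cong)
qed

section \<open>Degrees and equations of the image entries\<close>

lemma split_sum_mem:
  assumes "graded_module G" "\<And>u v. u @ v = xs \<Longrightarrow> h u v \<in> component G d"
  shows "split_sum xs h \<in> component G d"
  unfolding split_sum_def
  by (rule module.subspace_sum[of "scal G"])
    (use assms in \<open>auto simp: graded_module_def splits2_def\<close>)

lemma cut_sum_mem:
  assumes "graded_module G" "\<And>b. concat b = xs \<Longrightarrow> [] \<notin> set b \<Longrightarrow> h b \<in> component G d"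
  shows "cut_sum xs h \<in> component G d"
  unfolding cut_sum_def
  by (rule module.subspace_sum[of "scal G"])
    (use assms in \<open>auto simp: graded_module_def cuts_def\<close>)

lemma sh_val_mem:
  assumes "graded_module B" "alg_family A B c h" "\<forall>x\<in>set xs. homog A x" "xs \<noteq> []"
  shows "sh_val h xs \<in> component B (deg xs + c)"
proof -
  have "list_all2 (\<lambda>x d. x \<in> component A d) (map snd xs) (map (\<lambda>x. fst x + 1) xs)"
    using assms(3) by (induction xs) (auto simp: homog_def)
  then have "h (map snd xs) \<in> component B (sum_list (map (\<lambda>x. fst x + 1) xs) + c - int (length (map snd xs)))"
    using assms(2,4) unfolding alg_family_def by blast
  moreover have "sum_list (map (\<lambda>x. fst x + 1) xs) + c - int (length (map snd xs)) = deg xs + c"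
    by (simp add: sum_list_shifted_degrees)
  ultimately have "h (map snd xs) \<in> component B (deg xs + c)"
    by (simp only:)
  then show ?thesis
    unfolding sh_val_def using assms(1) sg_mem graded_module_def by blast
qed

lemma alg_mc_push:
  assumes f: "ainf_morphism A B f" and B: "ainf_algebra B" and mc: "alg_mc A e \<alpha> L"
  shows "alg_mc B e (push_alg e f \<alpha>) L"
  unfolding alg_mc_def
proof (intro allI impI conjI; elim conjE)
  fix b assume b: "b \<noteq> []" "sublist b L"
  have fam: "alg_family A B 1 f" and gB: "graded_module B" and muB: "alg_family B B 2 (mu B)"
    using f B by (auto simp: ainf_morphism_def ainf_algebra_def)
  show "homog B (push_alg e f \<alpha> b)"
    unfolding homog_def push_alg_def fst_conv snd_conv
  proof (rule cut_sum_mem[OF gB])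
    fix bss assume bss: "concat bss = b" "[] \<notin> set bss"
    then have "sh_val f (map \<alpha> bss) \<in> component B (deg (map \<alpha> bss) + 1)"
      using alg_mc_blocks(2)[OF mc] b by (intro sh_val_mem[OF gB fam]) auto
    then show "sh_val f (map \<alpha> bss) \<in> component B (sdeg e b + 1)"
      using alg_mc_blocks(1)[OF mc] b bss by simp
  qed
  show "fst (push_alg e f \<alpha> b) = sdeg e b"
    by (simp add: push_alg_def)
  have "cut_sum b (\<lambda>bss. sh_val (mu B) (map (push_alg e f \<alpha>) bss)) =
      cut_sum b (\<lambda>css. cut_sum (map \<alpha> css) (\<lambda>dss. sh_val (mu B) (map (sh 0 f) dss)))"
    by (rule cut_sum_push_alg[OF mc b(2) slot_additive_sh_val[OF muB]])
  \<comment> \<open>The morphism equation is applied to each fine cut; the summand \<open>0\<close>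
    only matches the parameter \<open>s\<close> of \<open>alg_mc_inner_sum\<close>.\<close>
  also have "\<dots> = cut_sum b (\<lambda>css. inner_sum (map \<alpha> css)
      (\<lambda>u v w. sg (0 + deg u) (sh_val f (u @ sh 1 (mu A) v # w))))"
  proof (rule cut_sum_cong)
    fix css assume css: "concat css = b" "[] \<notin> set css"
    then have "map \<alpha> css \<noteq> [] \<and> (\<forall>x\<in>set (map \<alpha> css). homog A x)"
      using alg_mc_blocks(2)[OF mc, of css] b by auto
    from f[unfolded ainf_morphism_def, THEN conjunct2, rule_format, OF this]
    show "cut_sum (map \<alpha> css) (\<lambda>dss. sh_val (mu B) (map (sh 0 f) dss)) =
        inner_sum (map \<alpha> css) (\<lambda>u v w. sg (0 + deg u) (sh_val f (u @ sh 1 (mu A) v # w)))"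
      by (simp add: cut_sum_def inner_sum_def)
  qed
  also have "\<dots> = 0"
    by (rule alg_mc_inner_sum[OF mc b(2) slot_additive_sh_val[OF fam]])
  finally show "cut_sum b (\<lambda>bss. sh_val (mu B) (map (push_alg e f \<alpha>) bss)) = 0" .
qed

lemma marked_sum_mem:
  assumes gN: "graded_module N" and fam: "mod_family A M N c F"
    and mc: "mod_mc A M e \<alpha> \<xi> z U V" and PQ: "suffix P U" "prefix Q V"
  shows "marked_sum \<alpha> \<xi> (shm_val F) P Q \<in> component N (sdeg e P + z + sdeg e Q + c + 1)"
  unfolding marked_sum_def
proof (intro split_sum_mem[OF gN] cut_sum_mem[OF gN])
  fix p p' q' q ps qs
  assume pieces: "p @ p' = P" "q' @ q = Q" "concat ps = p" "[] \<notin> set ps" "concat qs = q" "[] \<notin> set qs"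
  note * = mod_mc_pieces'[OF mc PQ pieces(1,2,3,5,4,6)]
  have "homog N (shm c F (map \<alpha> ps) (\<xi> p' q') (map \<alpha> qs))"
    using * by (intro homog_shm[OF gN fam]) auto
  then show "shm_val F (map \<alpha> ps) (\<xi> p' q') (map \<alpha> qs) \<in> component N (sdeg e P + z + sdeg e Q + c + 1)"
    using *(1,2,3) pieces by (auto simp: homog_def shm_def algebra_simps)
qed

text \<open>By \<open>marked_sum_push\<close> the sum over all marked cuts in the image is the
  right-hand side of the morphism equation, and the left-hand side vanishes on a Maurer--Cartan
  element. Evenness of \<open>c\<close> removes the signs \<open>sg c\<close> and
  \<open>sg (c * deg u)\<close>, which the former sum does not have.\<close>

lemma mod_mc_push:
  assumes f: "ainf_morphism A B f" and B: "ainf_algebra B" and N: "ainf_module B N"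
    and F: "module_morphism A M N (shm_val (act N)) f c F" and c: "even c"
    and mc: "mod_mc A M e \<alpha> \<xi> z U V"
  shows "mod_mc B N e (push_alg e f \<alpha>) (push_mod e (z + c) F \<alpha> \<xi>) (z + c) U V"
  unfolding mod_mc_def
proof (intro allI impI conjI; (elim conjE)?)
  show "alg_mc B e (push_alg e f \<alpha>) U" "alg_mc B e (push_alg e f \<alpha>) V"
    using mc by (auto intro: alg_mc_push[OF f B] simp: mod_mc_def)
  fix P Q assume PQ: "suffix P U" "prefix Q V"
  have gN: "graded_module N" and actN: "mod_family B N N 1 (act N)" and fam: "mod_family A M N c F"
    using N F by (auto simp: ainf_module_def module_morphism_def)
  show "homog N (push_mod e (z + c) F \<alpha> \<xi> P Q)"
    using marked_sum_mem[OF gN fam mc PQ] by (simp add: homog_def push_mod_def algebra_simps)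
  show "fst (push_mod e (z + c) F \<alpha> \<xi> P Q) = sdeg e P + (z + c) + sdeg e Q"
    by (simp add: push_mod_def)
  have "marked_sum (push_alg e f \<alpha>) (push_mod e (z + c) F \<alpha> \<xi>) (shm_val (act N)) P Q =
      marked_sum \<alpha> \<xi> (comp_act A M F) P Q"
    unfolding marked_sum_push[OF mc PQ marked_additive_shm_val[OF actN]]
  proof (rule marked_sum_cong)
    fix p p' q' q ps qs
    assume pieces: "p @ p' = P" "q' @ q = Q" "concat ps = p" "[] \<notin> set ps" "concat qs = q" "[] \<notin> set qs"
    note * = mod_mc_pieces'[OF mc PQ pieces(1,2,3,5,4,6)]
    have "comp_act A M F (map \<alpha> ps) (\<xi> p' q') (map \<alpha> qs) =
        split_sum (map \<alpha> ps) (\<lambda>u u'. cut_sum u (\<lambda>us. split_sum (map \<alpha> qs) (\<lambda>w' w. cut_sum w (\<lambda>ws.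
          shm_val (act N) (map (sh 0 f) us) (shm c F u' (\<xi> p' q') w') (map (sh 0 f) ws)))))"
      using F[unfolded module_morphism_def, THEN conjunct2, rule_format, OF conjI, OF *(4,5)] c
      by (simp add: split_sum_def cut_sum_def sg_even)
    then show "split_sum (map \<alpha> ps) (\<lambda>u u'. split_sum (map \<alpha> qs) (\<lambda>w' w. cut_sum u (\<lambda>us. cut_sum w (\<lambda>ws.
          shm_val (act N) (map (sh 0 f) us) (shm c F u' (\<xi> p' q') w') (map (sh 0 f) ws))))) =
        comp_act A M F (map \<alpha> ps) (\<xi> p' q') (map \<alpha> qs)"
      by (simp add: cut_split_sum_swap)
  qed
  also have "\<dots> = 0"
    by (rule marked_sum_comp_act[OF mc PQ marked_additive_shm_val[OF fam]])
  finally show "marked_sum (push_alg e f \<alpha>) (push_mod e (z + c) F \<alpha> \<xi>) (shm_val (act N)) P Q = 0" .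
qed

text \<open>\<open>homog_shm\<close> asks for a \<open>graded_module\<close>, where every element of
  the type decomposes, but the type of \<open>dual M\<close> also contains functions that are not
  linear. Only closure of a component under sign change is needed, which is checked
  directly.\<close>

lemma homog_dual_shm:
  assumes G: "mod_family A M (dual M) c G" and "\<forall>x\<in>set as \<union> set bs. homog A x" "homog M m"
  shows "homog (dual M) (shm c G as m bs)"
proof -
  have l: "list_all2 (\<lambda>x d. x \<in> component A d) (map snd xs) (map (\<lambda>x. fst x + 1) xs)"
    if "\<forall>x\<in>set xs. homog A x" for xs
    using that by (induction xs) (auto simp: homog_def)
  have "G (map snd as) (snd m) (map snd bs) \<in> component (dual M) (sum_list (map (\<lambda>x. fst x + 1) as) +
     (fst m + 1) + sum_list (map (\<lambda>x. fst x + 1) bs) + c - int (length (map snd as)) - int (length (map snd bs)))"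
    using assms(2,3) l
    by (intro G[unfolded mod_family_def, THEN conjunct2, THEN conjunct2, THEN conjunct2, rule_format] conjI)
      (auto simp: homog_def)
  moreover have "sum_list (map (\<lambda>x. fst x + 1) as) + (fst m + 1) + sum_list (map (\<lambda>x. fst x + 1) bs) + c
      - int (length (map snd as)) - int (length (map snd bs)) = deg as + fst m + deg bs + c + 1"
    by (simp add: sum_list_shifted_degrees)
  ultimately have "G (map snd as) (snd m) (map snd bs) \<in> component (dual M) (deg as + fst m + deg bs + c + 1)"
    by (simp only:)
  then show ?thesis
    by (auto simp: homog_def shm_def shm_val_def sg_def dual_def module_hom_iff algebra_simps)
qed

text \<open>Linearity of the value comes from its membership in a component of the dual, which
  \<open>mod_family\<close> grants at homogeneous arguments.\<close>

lemma additive_shm_val_dual: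
  assumes "mod_family A M (dual M) c G" "\<forall>x\<in>set as \<union> set bs. homog A x" "homog M m"
  shows "additive (shm_val G as m bs)"
  using homog_dual_shm[OF assms] additive_module_hom
  by (auto simp: homog_def shm_def dual_def)

lemma additive_apply: "additive (\<lambda>g. g x)"
  by (simp add: additive_def)

lemma marked_sum_apply: "marked_sum \<alpha> \<xi> H P Q x = marked_sum \<alpha> \<xi> (\<lambda>as m bs. H as m bs x) P Q"
  by (rule marked_sum_additive[OF additive_apply])

text \<open>Needed to move sums out of the argument at which the form is evaluated, that is, to
  expand entries of the second family.\<close>

lemma additive_marked_sum:
  assumes G: "mod_family A M (dual M) c G"
    and mc: "mod_mc A M e \<alpha> \<xi> z U V" and PQ: "suffix P U" "prefix Q V"
  shows "additive (marked_sum \<alpha> \<xi> (shm_val G) P Q)"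
  unfolding additive_def
proof (intro allI)
  fix x y
  have "shm_val G (map \<alpha> ps) (\<xi> p' q') (map \<alpha> qs) (x + y) =
      shm_val G (map \<alpha> ps) (\<xi> p' q') (map \<alpha> qs) x + shm_val G (map \<alpha> ps) (\<xi> p' q') (map \<alpha> qs) y"
    if pieces: "p @ p' = P" "q' @ q = Q" "concat ps = p" "[] \<notin> set ps" "concat qs = q" "[] \<notin> set qs"
    for p p' q' q ps qs
    using additive_shm_val_dual[OF G] mod_mc_pieces'(4,5)[OF mc PQ pieces(1,2,3,5,4,6)]
    by (meson additive.add)
  then show "marked_sum \<alpha> \<xi> (shm_val G) P Q (x + y) =
      marked_sum \<alpha> \<xi> (shm_val G) P Q x + marked_sum \<alpha> \<xi> (shm_val G) P Q y"
    unfolding marked_sum_apply marked_sum_add[symmetric] by (intro marked_sum_cong)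
qed

subsection \<open>Staircase inner products\<close>

text \<open>\<open>U\<close> and \<open>V\<close> are the words of algebra labels to the left and to the right of the first module label,
  \<open>z\<close> and \<open>z'\<close> the shifted degrees of the two module elements.  The interval \<open>[p, q]\<close> is \<open>P\<close>, the first
  module label, \<open>Q\<close>; its cyclic complement is \<open>Y\<close>, the second module label, \<open>X\<close>.\<close>

definition staircase_sum ::
  "(nat \<Rightarrow> int) \<Rightarrow> int \<Rightarrow> int \<Rightarrow> (nat list \<Rightarrow> 'a tagged) \<Rightarrow>
   (nat list \<Rightarrow> nat list \<Rightarrow> 'm tagged) \<Rightarrow> (nat list \<Rightarrow> nat list \<Rightarrow> 'm tagged) \<Rightarrow>
   ('a tagged list \<Rightarrow> 'm tagged \<Rightarrow> 'a tagged list \<Rightarrow> 'm tagged \<Rightarrow> 'r::ab_group_add) \<Rightarrow>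
   nat list \<Rightarrow> nat list \<Rightarrow> 'r" where
  "staircase_sum e z z' \<alpha> \<xi> \<xi>' H U V =
     split_sum U (\<lambda>X P. split_sum V (\<lambda>Q Y. sg (sdeg e X * (sdeg e P + z + sdeg e V + z'))
       (marked_sum \<alpha> \<xi> (\<lambda>as m bs. H as m bs (\<xi>' Y X)) P Q)))"

text \<open>Both sides run over the splittings of \<open>U\<close> into \<open>X\<close>,
  \<open>p\<close>, \<open>P'\<close> and of \<open>V\<close> into \<open>Q'\<close>,
  \<open>q\<close>, \<open>Y\<close>. On the left \<open>p\<close> and \<open>q\<close> belong to
  the interval around the first module label, on the right to its cyclic complement, which reads
  \<open>q\<close>, \<open>Y\<close>, second module label, \<open>X\<close>,
  \<open>p\<close>.\<close>

lemma split_sum_regroup: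
  "split_sum U (\<lambda>X P. split_sum V (\<lambda>Q Y. split_sum P (\<lambda>p P'. split_sum Q (\<lambda>Q' q.
     cut_sum p (\<lambda>ps. cut_sum q (\<lambda>qs. R X p P' Q' q Y ps qs)))))) =
   split_sum U (\<lambda>X P'. split_sum V (\<lambda>Q' Y. split_sum Y (\<lambda>q Y'. split_sum X (\<lambda>X' p.
     cut_sum q (\<lambda>qs. cut_sum p (\<lambda>ps. R X' p P' Q' q Y' ps qs))))))" (is "?l = ?r")
proof -
  let ?R = "\<lambda>X p P' Q' q Y. cut_sum p (\<lambda>ps. cut_sum q (\<lambda>qs. R X p P' Q' q Y ps qs))"
  have "?l = split_sum U (\<lambda>X P. split_sum P (\<lambda>p P'. split_sum V (\<lambda>Q Y. split_sum Q (\<lambda>Q' q.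
      ?R X p P' Q' q Y))))"
    by (intro split_sum_cong split_sum_swap)
  also have "\<dots> = split_sum U (\<lambda>X P'. split_sum X (\<lambda>X' p. split_sum V (\<lambda>Q' Y. split_sum Y (\<lambda>q Y'.
      ?R X' p P' Q' q Y'))))"
    unfolding split_sum_assoc ..
  also have "\<dots> = split_sum U (\<lambda>X P'. split_sum V (\<lambda>Q' Y. split_sum X (\<lambda>X' p. split_sum Y (\<lambda>q Y'.
      ?R X' p P' Q' q Y'))))"
    by (intro split_sum_cong split_sum_swap)
  also have "\<dots> = split_sum U (\<lambda>X P'. split_sum V (\<lambda>Q' Y. split_sum Y (\<lambda>q Y'. split_sum X (\<lambda>X' p.
      ?R X' p P' Q' q Y'))))"
    by (intro split_sum_cong split_sum_swap)
  also have "\<dots> = ?r"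
    by (intro split_sum_cong cut_sum_swap)
  finally show ?thesis .
qed

text \<open>Removing the outer arguments \<open>a0\<close> and \<open>b2\<close> first leaves, for
  \<open>r\<close> and \<open>s\<close>, exactly the expression produced by
  \<open>marked_sum_push\<close> for \<open>J\<close>. For even \<open>c\<close> only the sign of
  moving \<open>a0\<close> to the end survives.\<close>

lemma pullback_val_split_sum:
  assumes "even c"
  shows "pullback_val f c F J as m bs m' =
    split_sum as (\<lambda>a0 r. split_sum bs (\<lambda>s b2. sg (deg a0 * (deg r + fst m + deg bs + fst m'))
      (split_sum r (\<lambda>u u'. split_sum s (\<lambda>w' w. cut_sum u (\<lambda>us. cut_sum w (\<lambda>ws.
        shm_val J (map (sh 0 f) us) (shm c F u' m w') (map (sh 0 f) ws)))))
        (shm_val F b2 m' a0))))" (is "_ = ?r")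
proof -
  let ?J = "\<lambda>us u' w' ws b2 a0.
    shm_val J (map (sh 0 f) us) (shm c F u' m w') (map (sh 0 f) ws) (shm_val F b2 m' a0)"
  have "pullback_val f c F J as m bs m' =
      split_sum as (\<lambda>a0 r. split_sum r (\<lambda>u a'. cut_sum u (\<lambda>us. split_sum bs (\<lambda>b' t. split_sum t (\<lambda>w b2.
        cut_sum w (\<lambda>ws. sg (deg a0 * (deg u + deg a' + fst m + deg bs + fst m')
            + c * deg u + c * (deg u + deg a' + fst m + deg b' + deg w))
          (?J us a' b' ws b2 a0)))))))"
    unfolding pullback_val_def splits3_split_sum cut_sum_def ..
  also have "\<dots> = split_sum as (\<lambda>a0 r. split_sum r (\<lambda>u a'. cut_sum u (\<lambda>us. split_sum bs (\<lambda>s b2.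
        split_sum s (\<lambda>b' w. cut_sum w (\<lambda>ws. sg (deg a0 * (deg r + fst m + deg bs + fst m'))
          (?J us a' b' ws b2 a0)))))))"
    unfolding split_sum_assoc using assms
    by (intro split_sum_cong cut_sum_cong sg_cong) (auto simp: algebra_simps)
  also have "\<dots> = split_sum as (\<lambda>a0 r. split_sum r (\<lambda>u a'. split_sum bs (\<lambda>s b2.
        split_sum s (\<lambda>b' w. cut_sum u (\<lambda>us. cut_sum w (\<lambda>ws. sg (deg a0 * (deg r + fst m + deg bs + fst m'))
          (?J us a' b' ws b2 a0)))))))"
    unfolding cut_split_sum_swap ..
  also have "\<dots> = split_sum as (\<lambda>a0 r. split_sum bs (\<lambda>s b2. split_sum r (\<lambda>u a'.
        split_sum s (\<lambda>b' w. cut_sum u (\<lambda>us. cut_sum w (\<lambda>ws. sg (deg a0 * (deg r + fst m + deg bs + fst m'))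
          (?J us a' b' ws b2 a0)))))))"
    by (intro split_sum_cong split_sum_swap)
  also have "\<dots> = ?r"
    by (simp add: split_sum_additive[OF additive_sg] cut_sum_additive[OF additive_sg]
      split_sum_additive[OF additive_apply] cut_sum_additive[OF additive_apply])
  finally show ?thesis .
qed

text \<open>A term of either side cuts \<open>U\<close> and \<open>V\<close> into three words each.  If \<open>X\<close>, \<open>p\<close>, \<open>P'\<close> are the
  three parts of \<open>U\<close>, and \<open>Z\<close> is the degree of everything not in \<open>X\<close>, \<open>p\<close>, then the signs agree because
  \<open>X (p + Z) + p (Z + X)\<close> and \<open>(X + p) Z\<close> are congruent modulo 2.\<close>

lemma staircase_sum_pullback:
  fixes J :: "'b::ab_group_add list \<Rightarrow> 'n::ab_group_add \<Rightarrow> 'b list \<Rightarrow> 'n \<Rightarrow> 'r::comm_ring_1"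
  assumes f: "ainf_morphism A B f" and B: "ainf_algebra B" and N: "ainf_module B N"
    and F: "module_morphism A M N (shm_val (act N)) f c F" and c: "even c"
    and J: "mod_family B N (dual N) d J"
    and mc: "mod_mc A M e \<alpha> \<xi> z U V" and mc': "mod_mc A M e \<alpha> \<xi>' z' V U"
  shows "staircase_sum e (z + c) (z' + c) (push_alg e f \<alpha>)
      (push_mod e (z + c) F \<alpha> \<xi>) (push_mod e (z' + c) F \<alpha> \<xi>')
      (\<lambda>as m bs m'. shm_val J as m bs (snd m')) U V =
    staircase_sum e z z' \<alpha> \<xi> \<xi>' (pullback_val f c F J) U V"
proof -
  let ?\<phi> = "push_alg e f \<alpha>" and ?\<eta> = "push_mod e (z + c) F \<alpha> \<xi>" and ?\<eta>' = "push_mod e (z' + c) F \<alpha> \<xi>'"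
  define H where "H as m bs = split_sum as (\<lambda>u u'. split_sum bs (\<lambda>w' w. cut_sum u (\<lambda>us. cut_sum w (\<lambda>ws.
      shm_val J (map (sh 0 f) us) (shm c F u' m w') (map (sh 0 f) ws)))))" for as m bs
  have mcB: "mod_mc B N e ?\<phi> ?\<eta> (z + c) U V"
    by (rule mod_mc_push[OF f B N F c mc])
  \<comment> \<open>The common summand of both sides: \<open>P'\<close> and \<open>Q'\<close> feed
    the composite with \<open>J\<close>, while \<open>q\<close>, \<open>Y\<close>, \<open>X\<close>,
    \<open>p\<close> feed the outer \<open>F\<close>, at whose value the form is evaluated.\<close>
  let ?R = "\<lambda>X p P' Q' q Y ps qs. sg ((sdeg e X + sdeg e p) * (sdeg e P' + z + sdeg e V + z'))
    (marked_sum \<alpha> \<xi> (\<lambda>as m bs. H as m bs (shm_val F (map \<alpha> qs) (\<xi>' Y X) (map \<alpha> ps))) P' Q')"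
  have "staircase_sum e (z + c) (z' + c) ?\<phi> ?\<eta> ?\<eta>' (\<lambda>as m bs m'. shm_val J as m bs (snd m')) U V =
    split_sum U (\<lambda>X P'. split_sum V (\<lambda>Q' Y. split_sum Y (\<lambda>q Y'. split_sum X (\<lambda>X' p.
     cut_sum q (\<lambda>qs. cut_sum p (\<lambda>ps. ?R X' p P' Q' q Y' ps qs))))))"
    unfolding staircase_sum_def
  proof (intro split_sum_cong)
    fix X P Q Y assume UV: "X @ P = U" "Q @ Y = V"
    have PQ: "suffix P U" "prefix Q V" using UV by (auto simp: suffix_def)
    have "marked_sum ?\<phi> ?\<eta> (\<lambda>as m bs. shm_val J as m bs (snd (?\<eta>' Y X))) P Q =
        marked_sum ?\<phi> ?\<eta> (shm_val J) P Q (marked_sum \<alpha> \<xi>' (shm_val F) Y X)"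
      by (simp add: marked_sum_apply push_mod_def)
    \<comment> \<open>The image entry at which the form is evaluated is expanded; the form is
      additive because the entries in \<open>mcB\<close> are homogeneous.\<close>
    also have "\<dots> = marked_sum \<alpha> \<xi>' (\<lambda>as m bs. marked_sum ?\<phi> ?\<eta> (shm_val J) P Q (shm_val F as m bs)) Y X"
      by (rule marked_sum_additive[OF additive_marked_sum[OF J mcB PQ]])
    also have "\<dots> = marked_sum \<alpha> \<xi>' (\<lambda>as m bs.
        marked_sum \<alpha> \<xi> (\<lambda>as' m' bs'. H as' m' bs' (shm_val F as m bs)) P Q) Y X"
      unfolding marked_sum_push[OF mc PQ marked_additive_shm_val[OF J]] H_def[symmetric] marked_sum_apply ..
    finally have *: "marked_sum ?\<phi> ?\<eta> (\<lambda>as m bs. shm_val J as m bs (snd (?\<eta>' Y X))) P Q = \<dots>" .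
    have "sg (sdeg e X * (sdeg e P + (z + c) + sdeg e V + (z' + c)))
          (marked_sum ?\<phi> ?\<eta> (\<lambda>as m bs. shm_val J as m bs (snd (?\<eta>' Y X))) P Q) =
        sg (sdeg e X * (sdeg e P + z + sdeg e V + z')) (marked_sum \<alpha> \<xi>' (\<lambda>as m bs.
          marked_sum \<alpha> \<xi> (\<lambda>as' m' bs'. H as' m' bs' (shm_val F as m bs)) P Q) Y X)"
      unfolding * using c by (intro sg_cong) (auto simp: algebra_simps)
    also have "\<dots> = split_sum Y (\<lambda>q Y'. split_sum X (\<lambda>X' p.
        cut_sum q (\<lambda>qs. cut_sum p (\<lambda>ps. ?R X' p P Q q Y' ps qs))))"
      unfolding marked_sum_def[of \<alpha> \<xi>'] split_sum_additive[OF additive_sg] cut_sum_additive[OF additive_sg]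
      by (intro split_sum_cong cut_sum_cong) auto
    finally show "sg (sdeg e X * (sdeg e P + (z + c) + sdeg e V + (z' + c)))
          (marked_sum ?\<phi> ?\<eta> (\<lambda>as m bs. shm_val J as m bs (snd (?\<eta>' Y X))) P Q) = \<dots>" .
  qed
  also have "\<dots> = split_sum U (\<lambda>X P. split_sum V (\<lambda>Q Y. split_sum P (\<lambda>p P'. split_sum Q (\<lambda>Q' q.
     cut_sum p (\<lambda>ps. cut_sum q (\<lambda>qs. ?R X p P' Q' q Y ps qs))))))"
    by (rule split_sum_regroup[symmetric])
  also have "\<dots> = staircase_sum e z z' \<alpha> \<xi> \<xi>' (pullback_val f c F J) U V"
    unfolding staircase_sum_def
  proof (intro split_sum_cong)
    fix X P Q Y assume UV: "X @ P = U" "Q @ Y = V"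
    have PQ: "suffix P U" "prefix Q V" and YX: "suffix Y V" "prefix X U" using UV by (auto simp: suffix_def)
    let ?s = "\<lambda>as m bs as' bs'. deg as' * (deg as + fst m + (deg bs + deg bs') + fst (\<xi>' Y X))"
    have \<xi>': "fst (\<xi>' Y X) = sdeg e Y + z' + sdeg e X"
      using mc' YX by (auto simp: mod_mc_def)
    have "marked_sum \<alpha> \<xi> (\<lambda>as m bs. pullback_val f c F J as m bs (\<xi>' Y X)) P Q =
        marked_sum \<alpha> \<xi> (\<lambda>as m bs. split_sum as (\<lambda>a0 r. split_sum bs (\<lambda>s b2.
          sg (?s r m s a0 b2) (H r m s (shm_val F b2 (\<xi>' Y X) a0))))) P Q"
      unfolding pullback_val_split_sum[OF c] H_def[symmetric]
      by (intro marked_sum_cong split_sum_cong) (auto simp flip: deg_append)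
    also have "\<dots> = split_sum P (\<lambda>p P'. split_sum Q (\<lambda>Q' q. cut_sum p (\<lambda>ps. cut_sum q (\<lambda>qs.
        marked_sum \<alpha> \<xi> (\<lambda>as m bs. sg (?s as m bs (map \<alpha> ps) (map \<alpha> qs))
          (H as m bs (shm_val F (map \<alpha> qs) (\<xi>' Y X) (map \<alpha> ps)))) P' Q'))))"
      by (rule marked_sum_assoc)
    finally have *: "marked_sum \<alpha> \<xi> (\<lambda>as m bs. pullback_val f c F J as m bs (\<xi>' Y X)) P Q = \<dots>" .
    show "split_sum P (\<lambda>p P'. split_sum Q (\<lambda>Q' q. cut_sum p (\<lambda>ps. cut_sum q (\<lambda>qs. ?R X p P' Q' q Y ps qs))))
      = sg (sdeg e X * (sdeg e P + z + sdeg e V + z'))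
        (marked_sum \<alpha> \<xi> (\<lambda>as m bs. pullback_val f c F J as m bs (\<xi>' Y X)) P Q)"
      unfolding * split_sum_additive[OF additive_sg] cut_sum_additive[OF additive_sg]
        marked_sum_additive[OF additive_sg] sg_sg
    proof (intro split_sum_cong cut_sum_cong marked_sum_cong sg_cong)
      fix p P' Q' q ps qs r P'' Q'' s rs ss
      assume a: "p @ P' = P" "Q' @ q = Q" "concat ps = p" "[] \<notin> set ps" "concat qs = q" "[] \<notin> set qs"
        "r @ P'' = P'" "Q'' @ s = Q'" "concat rs = r" "[] \<notin> set rs" "concat ss = s" "[] \<notin> set ss"
      note 1 = mod_mc_pieces'[OF mc PQ a(1,2,3,5,4,6)]
      note 2 = mod_mc_pieces'[OF mc 1(6,7) a(7,8,9,11,10,12)]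
      show "even ((sdeg e X + sdeg e p) * (sdeg e P' + z + sdeg e V + z') - (sdeg e X * (sdeg e P + z + sdeg e V + z') +
          ?s (map \<alpha> rs) (\<xi> P'' Q'') (map \<alpha> ss) (map \<alpha> ps) (map \<alpha> qs)))"
        unfolding 1(1,2) 2(1,2,3) \<xi>' a(1,2,7,8)[symmetric] UV(2)[symmetric]
        by (auto simp: algebra_simps)
    qed
  qed
  finally show ?thesis .
qed

lemma sg_apply: "sg s g x = sg s (g x)"
  by (simp add: sg_def)

text \<open>The part of \<open>\<delta>(G)\<close> coming from the dual module evaluates \<open>G\<close> at module actions on entries of the
  second family; collecting the terms with the same arguments of \<open>G\<close> gives the equation of that family.\<close>

lemma staircase_sum_delta:
  assumes M: "ainf_module A M" and G: "mod_family A M (dual M) c G"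
    and mc: "mod_mc A M e \<alpha> \<xi> z U V" and mc': "mod_mc A M e \<alpha> \<xi>' z' V U"
  shows "staircase_sum e z z' \<alpha> \<xi> \<xi>'
    (\<lambda>as m bs m'. delta A M (dual_act_val M) c G as m bs (snd m')) U V = 0"
proof -
  \<comment> \<open>The exponent is free of \<open>c\<close>: the value of \<open>G\<close> has
    degree \<open>sdeg e P' + z + sdeg e Q' + c\<close>, and this \<open>c\<close> cancels against
    \<open>sg (c + 1)\<close> and, multiplied by the degree of \<open>p\<close>, against
    \<open>sg (c * deg u)\<close>. The minus signs of \<open>delta\<close> and of the dual action
    cancel as well.\<close>
  let ?R = "\<lambda>X p P' Q' q Y ps qs.
    sg ((sdeg e X + sdeg e p) * (sdeg e P' + z + sdeg e V + z') + (sdeg e P' + z + sdeg e Q'))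
      (marked_sum \<alpha> \<xi> (shm_val G) P' Q' (shm_val (act M) (map \<alpha> qs) (\<xi>' Y X) (map \<alpha> ps)))"
  have "staircase_sum e z z' \<alpha> \<xi> \<xi>' (\<lambda>as m bs m'. delta A M (dual_act_val M) c G as m bs (snd m')) U V =
    split_sum U (\<lambda>X P. split_sum V (\<lambda>Q Y. split_sum P (\<lambda>p P'. split_sum Q (\<lambda>Q' q.
     cut_sum p (\<lambda>ps. cut_sum q (\<lambda>qs. ?R X p P' Q' q Y ps qs))))))"
    unfolding staircase_sum_def
  proof (intro split_sum_cong)
    fix X P Q Y assume UV: "X @ P = U" "Q @ Y = V"
    have PQ: "suffix P U" "prefix Q V" and YX: "suffix Y V" "prefix X U" using UV by (auto simp: suffix_def)
    have \<xi>': "fst (\<xi>' Y X) = sdeg e Y + z' + sdeg e X" "homog M (\<xi>' Y X)"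
      using mc' YX by (auto simp: mod_mc_def)
    let ?D = "\<lambda>u u' m w' w. sg (c * deg u) (dual_act_val M u (shm c G u' m w') w (snd (\<xi>' Y X)))"
    have "marked_sum \<alpha> \<xi> (\<lambda>as m bs. delta A M (dual_act_val M) c G as m bs (snd (\<xi>' Y X))) P Q =
        marked_sum \<alpha> \<xi> (\<lambda>as m bs. comp_act A M G as m bs (snd (\<xi>' Y X)) +
          - sg c (split_sum as (\<lambda>u u'. split_sum bs (\<lambda>w' w. ?D u u' m w' w)))) P Q"
      by (simp add: delta_def split_sum_def[symmetric] split_sum_additive[OF additive_apply] sg_apply)
    \<comment> \<open>The \<open>comp_act\<close> part vanishes as a linear form, before evaluation,
      by the equations of the first family.\<close>
    also have "\<dots> = marked_sum \<alpha> \<xi> (\<lambda>as m bs.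
          - sg c (split_sum as (\<lambda>u u'. split_sum bs (\<lambda>w' w. ?D u u' m w' w)))) P Q"
      unfolding marked_sum_add marked_sum_apply[symmetric]
      by (simp add: marked_sum_comp_act[OF mc PQ marked_additive_shm_val[OF G]])
    also have "\<dots> = sg (c + 1) (marked_sum \<alpha> \<xi> (\<lambda>as m bs.
          split_sum as (\<lambda>u u'. split_sum bs (\<lambda>w' w. ?D u u' m w' w))) P Q)"
      unfolding marked_sum_additive[OF additive_sg] by (intro marked_sum_cong) (simp add: sg_def)
    also have "\<dots> = sg (c + 1) (split_sum P (\<lambda>p P'. split_sum Q (\<lambda>Q' q. cut_sum p (\<lambda>ps. cut_sum q (\<lambda>qs.
        marked_sum \<alpha> \<xi> (\<lambda>as m bs. ?D (map \<alpha> ps) as m bs (map \<alpha> qs)) P' Q')))))"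
      by (rule arg_cong[OF marked_sum_assoc])
    finally have *: "marked_sum \<alpha> \<xi> (\<lambda>as m bs. delta A M (dual_act_val M) c G as m bs (snd (\<xi>' Y X))) P Q = \<dots>" .
    show "sg (sdeg e X * (sdeg e P + z + sdeg e V + z'))
        (marked_sum \<alpha> \<xi> (\<lambda>as m bs. delta A M (dual_act_val M) c G as m bs (snd (\<xi>' Y X))) P Q) =
      split_sum P (\<lambda>p P'. split_sum Q (\<lambda>Q' q. cut_sum p (\<lambda>ps. cut_sum q (\<lambda>qs. ?R X p P' Q' q Y ps qs))))"
      unfolding * split_sum_additive[OF additive_sg] cut_sum_additive[OF additive_sg]
        marked_sum_additive[OF additive_sg] marked_sum_apply
    proof (intro split_sum_cong cut_sum_cong marked_sum_cong)
      fix p P' Q' q ps qs r P'' Q'' s rs ss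
      assume a: "p @ P' = P" "Q' @ q = Q" "concat ps = p" "[] \<notin> set ps" "concat qs = q" "[] \<notin> set qs"
        "r @ P'' = P'" "Q'' @ s = Q'" "concat rs = r" "[] \<notin> set rs" "concat ss = s" "[] \<notin> set ss"
      note 1 = mod_mc_pieces'[OF mc PQ a(1,2,3,5,4,6)]
      note 2 = mod_mc_pieces'[OF mc 1(6,7) a(7,8,9,11,10,12)]
      let ?\<phi> = "shm c G (map \<alpha> rs) (\<xi> P'' Q'') (map \<alpha> ss)"
      let ?x = "shm_val G (map \<alpha> rs) (\<xi> P'' Q'') (map \<alpha> ss) (shm_val (act M) (map \<alpha> qs) (\<xi>' Y X) (map \<alpha> ps))"
      have \<phi>: "homog (dual M) ?\<phi>" "fst ?\<phi> = sdeg e P' + z + sdeg e Q' + c"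
        "snd ?\<phi> = shm_val G (map \<alpha> rs) (\<xi> P'' Q'') (map \<alpha> ss)"
        using homog_dual_shm[OF G 2(4,5)] 2(1,2,3) a by (auto simp: shm_def)
      have "dual_act_val M (map \<alpha> ps) ?\<phi> (map \<alpha> qs) (snd (\<xi>' Y X)) =
          sg (deg (map \<alpha> ps) * (fst ?\<phi> + deg (map \<alpha> qs) + fst (\<xi>' Y X)) + fst ?\<phi> + 1) ?x"
        unfolding dual_act_val_homog[OF M 1(4) \<phi>(1) \<xi>'(2)] \<phi>(3) by (simp add: sg_def)
      then show "sg (sdeg e X * (sdeg e P + z + sdeg e V + z')) (sg (c + 1) (sg (c * deg (map \<alpha> ps))
          (dual_act_val M (map \<alpha> ps) ?\<phi> (map \<alpha> qs) (snd (\<xi>' Y X))))) =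
        sg ((sdeg e X + sdeg e p) * (sdeg e P' + z + sdeg e V + z') + (sdeg e P' + z + sdeg e Q')) ?x"
        unfolding 1(1,2) \<phi>(2) \<xi>' a(1,2)[symmetric] UV(2)[symmetric]
        by (auto simp: sg_sg algebra_simps intro!: sg_cong)
    qed
  qed
  also have "\<dots> = split_sum U (\<lambda>X P'. split_sum V (\<lambda>Q' Y. split_sum Y (\<lambda>q Y'. split_sum X (\<lambda>X' p.
     cut_sum q (\<lambda>qs. cut_sum p (\<lambda>ps. ?R X' p P' Q' q Y' ps qs))))))"
    by (rule split_sum_regroup)
  also have "\<dots> = 0"
  proof (rule split_sum_eq_0, rule split_sum_eq_0)
    fix X P Q Y assume UV: "X @ P = U" "Q @ Y = V"
    have PQ: "suffix P U" "prefix Q V" and YX: "suffix Y V" "prefix X U" using UV by (auto simp: suffix_def)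
    \<comment> \<open>The sign depends on \<open>X\<close> and \<open>Y\<close> but not on how they
      are split, so it leaves the sum over the marked cuts of the complement.\<close>
    let ?g = "\<lambda>x. sg (sdeg e X * (sdeg e P + z + sdeg e V + z') + (sdeg e P + z + sdeg e Q))
      (marked_sum \<alpha> \<xi> (shm_val G) P Q x)"
    have g: "additive ?g"
      by (intro additive_comp[OF additive_sg] additive_marked_sum[OF G mc PQ])
    have "split_sum Y (\<lambda>q Y'. split_sum X (\<lambda>X' p.
        cut_sum q (\<lambda>qs. cut_sum p (\<lambda>ps. ?R X' p P Q q Y' ps qs)))) =
      marked_sum \<alpha> \<xi>' (\<lambda>as m bs. ?g (shm_val (act M) as m bs)) Y X"
      unfolding marked_sum_def[of \<alpha> \<xi>'] by (intro split_sum_cong cut_sum_cong) auto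
    also have "\<dots> = ?g (marked_sum \<alpha> \<xi>' (shm_val (act M)) Y X)"
      by (rule marked_sum_additive[OF g, symmetric])
    also have "\<dots> = ?g 0"
      using mc' YX by (simp add: mod_mc_def)
    also have "\<dots> = 0"
      by (rule additive.zero[OF g])
    finally show "split_sum Y (\<lambda>q Y'. split_sum X (\<lambda>X' p.
        cut_sum q (\<lambda>qs. cut_sum p (\<lambda>ps. ?R X' p P Q q Y' ps qs)))) = 0" .
  qed
  finally show ?thesis .
qed

subsection \<open>Families indexed by intervals\<close>

text \<open>As \<open>c\<close> occurs only once, a marked cut is determined by the parts
  \<open>p'\<close> and \<open>q'\<close> that the marked block takes from \<open>P\<close> and
  \<open>Q\<close>, and by cuts of the rest.\<close>

lemma sum_mcuts:
  assumes "c \<notin> set P" "c \<notin> set Q"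
  shows "(\<Sum>(pre, b, post)\<in>mcuts c (P @ c # Q). H pre b post) =
    split_sum P (\<lambda>p p'. split_sum Q (\<lambda>q' q. cut_sum p (\<lambda>ps. cut_sum q (\<lambda>qs. H ps (p' @ c # q') qs))))"
proof -
  let ?S = "SIGMA t:splits2 P. SIGMA s:splits2 Q. SIGMA ps:cuts (fst t). cuts (snd s)"
  let ?j = "\<lambda>(t, s, ps, qs). (ps, snd t @ c # fst s, qs)"
  \<comment> \<open>The marked block is taken apart at its only occurrence of \<open>c\<close>,
    which gives back \<open>p'\<close> and \<open>q'\<close>.\<close>
  let ?i = "\<lambda>(pre, b, post). ((concat pre, takeWhile (\<lambda>x. x \<noteq> c) b),
    (tl (dropWhile (\<lambda>x. x \<noteq> c) b), concat post), pre, post)"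
  have "split_sum P (\<lambda>p p'. split_sum Q (\<lambda>q' q. cut_sum p (\<lambda>ps. cut_sum q (\<lambda>qs. H ps (p' @ c # q') qs)))) =
      (\<Sum>(t, s, ps, qs)\<in>?S. H ps (snd t @ c # fst s) qs)"
    unfolding split_sum_def cut_sum_def case_prod_unfold
    by (simp add: sum.Sigma finite_splits2 finite_cuts finite_SigmaI case_prod_unfold)
  also have "\<dots> = (\<Sum>(pre, b, post)\<in>mcuts c (P @ c # Q). H pre b post)"
  proof (rule sum.reindex_bij_witness[where i = ?i and j = ?j])
    fix x assume "x \<in> ?S"
    then obtain p p' q' q ps qs where x: "x = ((p, p'), (q', q), ps, qs)"
      and *: "P = p @ p'" "Q = q' @ q" "concat ps = p" "concat qs = q" "[] \<notin> set ps" "[] \<notin> set qs"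
      by (auto simp: splits2_def cuts_def)
    have "\<forall>y\<in>set p'. y \<noteq> c" using assms * by auto
    then show "?i (?j x) = x" by (simp add: x * takeWhile_append2 dropWhile_append2)
    show "?j x \<in> mcuts c (P @ c # Q)" by (simp add: x mcuts_def cuts_def *)
    show "(case ?j x of (pre, b, post) \<Rightarrow> H pre b post) =
        (case x of (t, s, ps, qs) \<Rightarrow> H ps (snd t @ c # fst s) qs)" by (simp add: x)
  next
    fix y assume "y \<in> mcuts c (P @ c # Q)"
    then obtain pre b post where y: "y = (pre, b, post)"
      and *: "concat pre @ b @ concat post = P @ c # Q" "[] \<notin> set pre" "[] \<notin> set post" "c \<in> set b"
      by (auto simp: mcuts_def cuts_def)
    obtain u v where b: "b = u @ c # v" "c \<notin> set u" using split_list_first[OF *(4)] by blast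
    have "P @ c # Q = (concat pre @ u) @ c # (v @ concat post)" using *(1) b by simp
    then have "P = concat pre @ u" "Q = v @ concat post"
      using append_Cons_eq_iff[OF assms] by blast+
    moreover have "\<forall>x\<in>set u. x \<noteq> c" using b(2) by auto
    then have "takeWhile (\<lambda>x. x \<noteq> c) b = u" "tl (dropWhile (\<lambda>x. x \<noteq> c) b) = v"
      using b by (auto simp: takeWhile_append2 dropWhile_append2)
    ultimately show "?j (?i y) = y" "?i y \<in> ?S" using * b by (auto simp: y splits2_def cuts_def)
  qed
  finally show ?thesis by simp
qed

text \<open>The dictionary between families indexed by end points and entries indexed by words.
  Agreement, tags included, is demanded on intervals only, since all other values of the families
  are arbitrary.\<close>

definition represents ::
  "nat \<Rightarrow> (nat \<Rightarrow> int) \<Rightarrow> (nat \<Rightarrow> nat \<Rightarrow> 'a) \<Rightarrow> (nat \<Rightarrow> nat \<Rightarrow> 'm) \<Rightarrow>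
   (nat list \<Rightarrow> 'a tagged) \<Rightarrow> (nat list \<Rightarrow> nat list \<Rightarrow> 'm tagged) \<Rightarrow> nat list \<Rightarrow> nat list \<Rightarrow> bool" where
  "represents c e xa xm \<alpha> \<xi> U V \<longleftrightarrow>
     (\<forall>b. b \<noteq> [] \<and> (sublist b U \<or> sublist b V) \<longrightarrow> entry e xa b = \<alpha> b) \<and>
     (\<forall>P Q. suffix P U \<and> prefix Q V \<longrightarrow> entry e xm (P @ c # Q) = \<xi> P Q)"

lemma represents_map:
  assumes "represents c e xa xm \<alpha> \<xi> U V" "sublist (concat ps) U \<or> sublist (concat ps) V" "[] \<notin> set ps"
  shows "map (entry e xa) ps = map \<alpha> ps"
proof (rule map_cong[OF refl])
  fix b assume b: "b \<in> set ps"
  then have "b \<noteq> []" using assms(3) by auto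
  moreover have "sublist b U \<or> sublist b V"
    using sublist_concat[OF b] assms(2) sublist_order.order_trans by blast
  ultimately show "entry e xa b = \<alpha> b" using assms(1) by (simp add: represents_def)
qed

lemma cut_sum_represents:
  assumes "represents c e xa xm \<alpha> \<xi> U V" "sublist b U \<or> sublist b V"
  shows "cut_sum b (\<lambda>bss. h (map (entry e xa) bss)) = cut_sum b (\<lambda>bss. h (map \<alpha> bss))"
  using assms(2) by (intro cut_sum_cong) (simp add: represents_map[OF assms(1)])

lemma sum_mcuts_represents:
  assumes rep: "represents c e xa xm \<alpha> \<xi> U V" and c: "c \<notin> set U" "c \<notin> set V"
    and PQ: "suffix P U" "prefix Q V"
  shows "(\<Sum>(pre, b, post)\<in>mcuts c (P @ c # Q).
      H (map (entry e xa) pre) (entry e xm b) (map (entry e xa) post)) = marked_sum \<alpha> \<xi> H P Q"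
proof -
  have "c \<notin> set P" "c \<notin> set Q"
    using c PQ by (meson in_mono set_mono_suffix set_mono_prefix)+
  then show ?thesis
    unfolding sum_mcuts[where H = "\<lambda>pre b post. H (map (entry e xa) pre) (entry e xm b) (map (entry e xa) post)", OF \<open>c \<notin> set P\<close> \<open>c \<notin> set Q\<close>] marked_sum_def
  proof (intro split_sum_cong cut_sum_cong)
    fix p p' q' q ps qs
    assume a: "p @ p' = P" "q' @ q = Q" "concat ps = p" "[] \<notin> set ps" "concat qs = q" "[] \<notin> set qs"
    have "suffix p' U" "prefix q' V" "sublist (concat ps) U" "sublist (concat qs) V"
      using a(1,2,3,5) PQ suffix_pieces prefix_pieces by blast+
    then have "map (entry e xa) ps = map \<alpha> ps" "map (entry e xa) qs = map \<alpha> qs"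
      "entry e xm (p' @ c # q') = \<xi> p' q'"
      using represents_map[OF rep] a rep by (blast, blast, simp add: represents_def)
    then show "H (map (entry e xa) ps) (entry e xm (p' @ c # q')) (map (entry e xa) qs) =
        H (map \<alpha> ps) (\<xi> p' q') (map \<alpha> qs)"
      by (simp only:)
  qed
qed

text \<open>The cut into one block is the only one that the staircase omits; its term is the
  differential, with no sign because there is a single argument.\<close>

lemma mu_eq_staircase_iff:
  assumes "v \<noteq> []"
  shows "mu A [xa (hd v) (last v)] = - staircase_alg A e xa v \<longleftrightarrow>
    cut_sum v (\<lambda>bss. sh_val (mu A) (map (entry e xa) bss)) = 0"
proof -
  have *: "cuts v = insert [v] {bss \<in> cuts v. length bss \<ge> 2}"
  proof (intro equalityI subsetI)
    fix bss assume "bss \<in> cuts v"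
    then show "bss \<in> insert [v] {bss \<in> cuts v. length bss \<ge> 2}"
      using assms by (cases bss; cases "tl bss") (auto simp: cuts_def)
  qed (use assms in \<open>auto simp: cuts_def\<close>)
  have "cut_sum v (\<lambda>bss. sh_val (mu A) (map (entry e xa) bss)) =
      sh_val (mu A) [entry e xa v] + staircase_alg A e xa v"
    unfolding cut_sum_def staircase_alg_def by (subst *, subst sum.insert) (auto simp: finite_cuts)
  moreover have "sh_val (mu A) [entry e xa v] = mu A [xa (hd v) (last v)]"
    by (simp add: sh_val_def entry_def sg_def)
  ultimately show ?thesis by (simp add: eq_neg_iff_add_eq_0)
qed

lemma act_eq_staircase_iff:
  assumes "c \<in> set v"
  shows "act M [] (xm (hd v) (last v)) [] = - staircase_mod M c e xa xm v \<longleftrightarrow>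
    (\<Sum>(pre, b, post)\<in>mcuts c v.
      shm_val (act M) (map (entry e xa) pre) (entry e xm b) (map (entry e xa) post)) = 0"
proof -
  have v: "v \<noteq> []" using assms by auto
  have *: "mcuts c v = insert ([], v, []) {(pre, b, post). (pre, b, post) \<in> mcuts c v \<and> (pre \<noteq> [] \<or> post \<noteq> [])}"
    using assms v by (auto simp: mcuts_def cuts_def)
  have fin: "finite {(pre, b, post). (pre, b, post) \<in> mcuts c v \<and> (pre \<noteq> [] \<or> post \<noteq> [])}"
    by (rule finite_subset[OF _ finite_mcuts[of c v]]) auto
  have "(\<Sum>(pre, b, post)\<in>mcuts c v.
        shm_val (act M) (map (entry e xa) pre) (entry e xm b) (map (entry e xa) post)) =
      shm_val (act M) [] (entry e xm v) [] + staircase_mod M c e xa xm v"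
    unfolding staircase_mod_def by (subst *, subst sum.insert[OF fin]) auto
  moreover have "shm_val (act M) [] (entry e xm v) [] = act M [] (xm (hd v) (last v)) []"
    by (simp add: shm_val_def entry_def sg_def)
  ultimately show ?thesis by (simp add: eq_neg_iff_add_eq_0)
qed

lemma intervals_marked:
  "v \<in> intervals (U @ c # V) \<longleftrightarrow> (\<exists>P Q. v = P @ c # Q \<and> suffix P U \<and> prefix Q V) \<or>
    v \<noteq> [] \<and> (sublist v U \<or> sublist v V)"
proof -
  have "v \<in> intervals (U @ c # V) \<longleftrightarrow> v \<noteq> [] \<and> sublist v (U @ c # V)"
    by (auto simp: intervals_def sublist_def)
  also have "\<dots> \<longleftrightarrow> (\<exists>P Q. v = P @ c # Q \<and> suffix P U \<and> prefix Q V) \<or>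
    v \<noteq> [] \<and> (sublist v U \<or> sublist v V)"
    unfolding sublist_append sublist_Cons_right prefix_Cons
    by (auto intro: suffix_imp_sublist) (metis append_Nil suffix_bot.bot_least)
  finally show ?thesis .
qed

lemma mod_mc_of_family:
  assumes c: "c \<notin> set U" "c \<notin> set V" and rep: "represents c e xa xm \<alpha> \<xi> U V"
    and fam: "triangular_family A M (U @ c # V) c e a m xa xm"
    and def: "defining_family A M (U @ c # V) c e xa xm"
  shows "mod_mc A M e \<alpha> \<xi> (e c - 1) U V"
proof -
  have alg: "homog A (\<alpha> b) \<and> fst (\<alpha> b) = sdeg e b \<and> cut_sum b (\<lambda>bss. sh_val (mu A) (map \<alpha> bss)) = 0"
    if b: "b \<noteq> []" "sublist b U \<or> sublist b V" for b
  proof -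
    have i: "b \<in> intervals (U @ c # V)" and c': "c \<notin> set b"
      using b c by (auto simp: intervals_marked dest: set_mono_sublist)
    have \<alpha>: "entry e xa b = \<alpha> b" using rep b by (auto simp: represents_def)
    show ?thesis
      using fam def i c' b mu_eq_staircase_iff[OF b(1), of A xa e] cut_sum_represents[OF rep b(2), of "sh_val (mu A)"]
      unfolding triangular_family_def defining_family_def \<alpha>[symmetric]
      by (auto simp: entry_def)
  qed
  have "homog M (\<xi> P Q) \<and> fst (\<xi> P Q) = sdeg e P + (e c - 1) + sdeg e Q \<and>
      marked_sum \<alpha> \<xi> (shm_val (act M)) P Q = 0"
    if PQ: "suffix P U" "prefix Q V" for P Q
  proof -
    have i: "P @ c # Q \<in> intervals (U @ c # V)" using PQ by (auto simp: intervals_marked)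
    have \<xi>: "entry e xm (P @ c # Q) = \<xi> P Q" using rep PQ by (auto simp: represents_def)
    show ?thesis
      using fam def i act_eq_staircase_iff[of c "P @ c # Q" M xm e xa] sum_mcuts_represents[OF rep c PQ, of "shm_val (act M)"]
      unfolding triangular_family_def defining_family_def \<xi>[symmetric]
      by (auto simp: entry_def)
  qed
  with alg show ?thesis by (auto simp: mod_mc_def alg_mc_def)
qed

text \<open>Two weights occur because the equations of an image are stated with the weights of the
  source, and its families with those of the target. The tags agree already by
  \<open>represents\<close>.\<close>

lemma family_of_mod_mc:
  assumes c: "c \<notin> set U" "c \<notin> set V" and rep: "represents c e xa xm \<alpha> \<xi> U V"
    and mc: "mod_mc A M e' \<alpha> \<xi> z U V"
    and diag: "\<forall>i\<in>set (U @ c # V). if i = c then xm i i = m i else xa i i = a i"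
  shows "triangular_family A M (U @ c # V) c e a m xa xm \<and> defining_family A M (U @ c # V) c e xa xm"
proof -
  have "(if c \<in> set v then homog M (entry e xm v) else homog A (entry e xa v)) \<and>
      (if c \<in> set v then act M [] (xm (hd v) (last v)) [] = - staircase_mod M c e xa xm v
       else mu A [xa (hd v) (last v)] = - staircase_alg A e xa v)"
    if v: "v \<in> intervals (U @ c # V)" for v
  proof (cases "\<exists>P Q. v = P @ c # Q \<and> suffix P U \<and> prefix Q V")
    case True
    then obtain P Q where PQ: "v = P @ c # Q" "suffix P U" "prefix Q V" by blast
    then show ?thesis
      using act_eq_staircase_iff[of c v M xm e xa] sum_mcuts_represents[OF rep c PQ(2,3), of "shm_val (act M)"] mc rep
      by (auto simp: mod_mc_def represents_def)
  next
    case False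
    then have v: "v \<noteq> []" "sublist v U \<or> sublist v V" using v by (auto simp: intervals_marked)
    moreover have "c \<notin> set v" using v c by (auto dest: set_mono_sublist)
    ultimately show ?thesis
      using mu_eq_staircase_iff[OF v(1), of A xa e] cut_sum_represents[OF rep v(2), of "sh_val (mu A)"] mc rep
      by (auto simp: mod_mc_def alg_mc_def represents_def)
  qed
  with diag show ?thesis by (simp add: triangular_family_def defining_family_def)
qed

section \<open>Words of consecutive labels and their end points\<close>

lemma upt_eq_append_ConsD:
  assumes "[a..<b] = u @ i # v"
  shows "u = [a..<i]" "v = [Suc i..<b]" "a \<le> i" "i < b"
proof -
  have len: "length u < b - a"
    using arg_cong[OF assms, of length] by simp
  have "i = [a..<b] ! length u" using assms by simp
  then have i: "i = a + length u" using len by simp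
  then show "a \<le> i" "i < b" using len by auto
  have "u = take (length u) [a..<b]" "v = drop (Suc (length u)) [a..<b]"
    using assms by auto
  then show "u = [a..<i]" "v = [Suc i..<b]"
    using i len by (auto simp: take_upt)
qed

text \<open>Appending \<open>b\<close> covers the empty suffix, which is \<open>[b..<b]\<close>; in
  the application \<open>b\<close> is the label that follows the suffix.\<close>

lemma suffix_upt:
  assumes "suffix P [a..<b]" "a \<le> b"
  shows "P = [hd (P @ [b])..<b] \<and> a \<le> hd (P @ [b])"
proof (cases P)
  case (Cons i v)
  then obtain u where "[a..<b] = u @ i # v" using assms(1) by (auto simp: suffix_def)
  from upt_eq_append_ConsD[OF this] show ?thesis by (simp add: Cons upt_conv_Cons)
qed (use assms in simp)

lemma prefix_upt:
  assumes "prefix Q [a..<b]" "Q \<noteq> []"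
  shows "Q = [a..<Suc (last Q)] \<and> a \<le> last Q \<and> last Q < b"
proof -
  obtain u i where Q: "Q = u @ [i]" using assms(2) by (cases Q rule: rev_cases) auto
  then obtain v where "[a..<b] = u @ i # v" using assms(1) by (auto simp: prefix_def)
  from upt_eq_append_ConsD[OF this] show ?thesis by (simp add: Q)
qed

lemma sublist_upt:
  assumes "sublist v [a..<b]" "v \<noteq> []"
  shows "v = [hd v..<Suc (last v)] \<and> a \<le> hd v \<and> hd v \<le> last v \<and> last v < b"
proof -
  obtain u w where *: "[a..<b] = u @ v @ w" using assms(1) by (auto simp: sublist_def)
  obtain i r where v: "v = i # r" using assms(2) by (cases v) auto
  with * have "[a..<b] = u @ i # r @ w" by simp
  note 1 = upt_eq_append_ConsD[OF this]
  have "[i..<b] = v @ w"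
    unfolding upt_conv_Cons[OF 1(4)] v append_Cons 1(2) ..
  from prefix_upt[OF prefixI[OF this] assms(2)] 1(3)
  have "v = [i..<Suc (last v)] \<and> a \<le> i \<and> i \<le> last v \<and> last v < b" by blast
  moreover have "hd v = i" by (simp add: v)
  ultimately show ?thesis by metis
qed

lemma upt_append: "a \<le> p \<Longrightarrow> p \<le> b \<Longrightarrow> [a..<p] @ [p..<b] = [a..<b]"
  by (metis le_Suc_ex upt_add_eq_append)

lemma split_sum_upt:
  assumes "a \<le> b"
  shows "split_sum [a..<b] h = (\<Sum>p\<in>{a..b}. h [a..<p] [p..<b])"
  unfolding split_sum_def
proof (rule sum.reindex_bij_witness[where j = "\<lambda>(u, v). a + length u" and i = "\<lambda>p. ([a..<p], [p..<b])"])
  fix x assume "x \<in> splits2 [a..<b]"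
  then obtain u v where x: "x = (u, v)" "u @ v = [a..<b]" by (auto simp: splits2_def)
  have len: "length u \<le> b - a" using arg_cong[OF x(2), of length] by simp
  have "u = take (length u) [a..<b]" "v = drop (length u) [a..<b]"
    by (simp_all add: x(2)[symmetric])
  then have uv: "u = [a..<a + length u]" "v = [a + length u..<b]"
    using len assms by (auto simp: take_upt)
  then show "(\<lambda>p. ([a..<p], [p..<b])) (case x of (u, v) \<Rightarrow> a + length u) = x" by (simp add: x(1))
  show "(case x of (u, v) \<Rightarrow> a + length u) \<in> {a..b}" using len assms by (simp add: x(1))
  show "h [a..<case x of (u, v) \<Rightarrow> a + length u] [case x of (u, v) \<Rightarrow> a + length u..<b] =
      (case x of (u, v) \<Rightarrow> h u v)" using uv by (simp add: x(1))
qed (auto simp: splits2_def upt_append)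

lemma upt_append_Cons: "a \<le> c \<Longrightarrow> c < b \<Longrightarrow> [a..<b] = [a..<c] @ c # [Suc c..<b]"
  by (metis le_add_diff_inverse less_imp_le_nat upt_add_eq_append upt_conv_Cons)

lemma order1_eq: "order1 k l = [1..<k + 1] @ (k + 1) # [k + 2..<k + l + 2]"
  unfolding order1_def by (subst upt_append_Cons[of _ "k + 1"]) auto

lemma order2_eq: "order2 k l = [k + 2..<k + l + 2] @ (k + l + 2) # [1..<k + 1]"
  unfolding order2_def by (subst upt_append_Cons[of _ "k + l + 2"]) auto

text \<open>The degrees of the module labels enter through \<open>z\<close> and \<open>z'\<close>
  only, and these labels are the only places where source and target weights differ.\<close>

lemma staircase_sum_weight_cong:
  assumes "\<forall>i\<in>set U \<union> set V. e i = e' i"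
  shows "staircase_sum e z z' \<alpha> \<xi> \<xi>' H U V = staircase_sum e' z z' \<alpha> \<xi> \<xi>' H U V"
proof -
  have sdeg: "sdeg e v = sdeg e' v" if "set v \<subseteq> set U \<union> set V" for v
    unfolding sdeg_def using that assms by (intro arg_cong[where f = sum_list] map_cong) auto
  have *: "sdeg e X = sdeg e' X" "sdeg e P = sdeg e' P" "sdeg e V = sdeg e' V" if "X @ P = U" for X P
    using that by (auto intro!: sdeg)
  show ?thesis
    unfolding staircase_sum_def by (intro split_sum_cong) (simp only: *)
qed

text \<open>Choosing \<open>p\<close> splits \<open>U\<close> before the label \<open>p\<close>,
  choosing \<open>q\<close> splits \<open>V\<close> after the label \<open>q\<close>, and the marked
  cuts of the interval between them form a \<open>marked_sum\<close>.\<close>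

lemma staircase_inner_eq:
  fixes I :: "'a::ab_group_add list \<Rightarrow> 'm \<Rightarrow> 'a list \<Rightarrow> 'm \<Rightarrow> 'c::comm_ring_1"
  assumes rep: "represents (k + 1) e xa xm \<alpha> \<xi> [1..<k + 1] [k + 2..<k + l + 2]"
    and rep': "represents (k + l + 2) e xa' xm' \<alpha> \<xi>' [k + 2..<k + l + 2] [1..<k + 1]"
  shows "staircase_inner I k l e xa xm xm' =
    staircase_sum e (e (k + 1) - 1) (e (k + l + 2) - 1) \<alpha> \<xi> \<xi>'
      (\<lambda>as m bs m'. shm_val I as m bs (snd m')) [1..<k + 1] [k + 2..<k + l + 2]"
proof -
  let ?U = "[1..<k + 1]" and ?V = "[k + 2..<k + l + 2]"
  have le: "1 \<le> k + 1" "k + 2 \<le> k + l + 2" by auto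
  \<comment> \<open>\<open>q\<close> is the last label of the interval, whereas a splitting of
    \<open>V\<close> is named by the first label after it; \<open>q = k + 1\<close> gives the empty
    word.\<close>
  have shift: "(\<Sum>p\<in>{k + 2..k + l + 2}. g p) = (\<Sum>q\<in>{k + 1..k + l + 1}. g (Suc q))" for g :: "nat \<Rightarrow> 'c"
    using sum.shift_bounds_cl_Suc_ivl[of g "k + 1" "k + l + 1"] by (simp del: sum.cl_ivl_Suc)
  have "staircase_sum e (e (k + 1) - 1) (e (k + l + 2) - 1) \<alpha> \<xi> \<xi>'
      (\<lambda>as m bs m'. shm_val I as m bs (snd m')) ?U ?V =
    (\<Sum>p\<in>{1..k + 1}. \<Sum>q\<in>{k + 1..k + l + 1}.
      sg (sdeg e [1..<p] * (sdeg e [p..<k + 1] + (e (k + 1) - 1) + sdeg e ?V + (e (k + l + 2) - 1)))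
       (marked_sum \<alpha> \<xi> (\<lambda>as m bs. shm_val I as m bs (snd (\<xi>' [Suc q..<k + l + 2] [1..<p])))
         [p..<k + 1] [k + 2..<Suc q]))"
    by (simp only: staircase_sum_def split_sum_upt[OF le(1)] split_sum_upt[OF le(2)] shift)
  also have "\<dots> = staircase_inner I k l e xa xm xm'"
    unfolding staircase_inner_def
  proof (intro sum.cong refl)
    fix p q assume p: "p \<in> {1..k + 1}" and q: "q \<in> {k + 1..k + l + 1}"
    let ?P = "[p..<k + 1]" and ?Q = "[k + 2..<Suc q]" and ?Y = "[Suc q..<k + l + 2]" and ?X = "[1..<p]"
    have UV: "?U = ?X @ ?P" "?V = ?Q @ ?Y"
      by (rule upt_append[symmetric]; use p q in simp)+
    have suf: "suffix ?P ?U" "suffix ?Y ?V" and pre: "prefix ?Q ?V" "prefix ?X ?U"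
      using suffixI[OF UV(1)] suffixI[OF UV(2)] prefixI[OF UV(2)] prefixI[OF UV(1)] by blast+
    have PQ: "[p..<q + 1] = ?P @ (k + 1) # ?Q"
      using upt_append_Cons[of p "k + 1" "q + 1"] p q by simp
    have \<xi>': "entry e xm' (?Y @ (k + l + 2) # ?X) = \<xi>' ?Y ?X"
      using rep' suf(2) pre(2) by (auto simp: represents_def)
    \<comment> \<open>In the boundary cases \<open>q = k + l + 1\<close> and \<open>p = 1\<close>
      the complement starts, respectively ends, with the second module label
      \<open>k + l + 2\<close>.\<close>
    have hd: "hd (?Y @ (k + l + 2) # ?X) = q + 1"
      using q by (cases "q = k + l + 1") (auto simp: upt_conv_Cons simp del: upt_Suc)
    have last: "last (?Y @ (k + l + 2) # ?X) = (if p = 1 then k + l + 2 else p - 1)"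
      using p by (auto simp: last_upt)
    have x: "snd (\<xi>' ?Y ?X) = xm' (q + 1) (if p = 1 then k + l + 2 else p - 1)"
      unfolding \<xi>'[symmetric] entry_def snd_conv hd last ..
    have "[p..<k + l + 3] = ?P @ (k + 1) # ?V @ [k + l + 2]"
      using upt_append_Cons[of p "k + 1" "k + l + 3"] upt_append_Cons[of "k + 2" "k + l + 2" "k + l + 3"] p
      by (simp del: upt_Suc)
    then have s: "sdeg e [p..<k + l + 3] = sdeg e ?P + (e (k + 1) - 1) + sdeg e ?V + (e (k + l + 2) - 1)"
      by (simp del: upt_Suc)
    show "sg (sdeg e ?X * (sdeg e ?P + (e (k + 1) - 1) + sdeg e ?V + (e (k + l + 2) - 1)))
       (marked_sum \<alpha> \<xi> (\<lambda>as m bs. shm_val I as m bs (snd (\<xi>' ?Y ?X))) ?P ?Q) =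
      (\<Sum>(pre, b, post)\<in>mcuts (k + 1) [p..<q + 1]. sg (sdeg e ?X * sdeg e [p..<k + l + 3])
          (shm_val I (map (entry e xa) pre) (entry e xm b) (map (entry e xa) post)
             (xm' (q + 1) (if p = 1 then k + l + 2 else p - 1))))"
      unfolding x s[symmetric] PQ marked_sum_additive[OF additive_sg]
      by (rule sum_mcuts_represents[OF rep _ _ suf(1) pre(1), symmetric]) auto
  qed
  finally show ?thesis by simp
qed

lemma staircase_sum_cong:
  assumes mc: "mod_mc A M e \<alpha> \<xi> z U V" and mc': "mod_mc A M e \<alpha> \<xi>' z' V U"
    and "\<And>as m bs m'. \<forall>x\<in>set as \<union> set bs. homog A x \<Longrightarrow> homog M m \<Longrightarrow> homog M m' \<Longrightarrow>
      H as m bs m' = H' as m bs m'"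
  shows "staircase_sum e z z' \<alpha> \<xi> \<xi>' H U V = staircase_sum e z z' \<alpha> \<xi> \<xi>' H' U V"
  unfolding staircase_sum_def
proof (intro split_sum_cong arg_cong2[where f = sg] refl marked_sum_cong)
  fix X P Q Y p p' q' q ps qs
  assume UV: "X @ P = U" "Q @ Y = V"
    and pieces: "p @ p' = P" "q' @ q = Q" "concat ps = p" "[] \<notin> set ps" "concat qs = q" "[] \<notin> set qs"
  have PQ: "suffix P U" "prefix Q V" and YX: "suffix Y V" "prefix X U" using UV by (auto simp: suffix_def)
  have "homog M (\<xi>' Y X)" using mc' YX by (auto simp: mod_mc_def)
  then show "H (map \<alpha> ps) (\<xi> p' q') (map \<alpha> qs) (\<xi>' Y X) = H' (map \<alpha> ps) (\<xi> p' q') (map \<alpha> qs) (\<xi>' Y X)"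
    using mod_mc_pieces'(4,5)[OF mc PQ pieces(1,2,3,5,4,6)] assms(3) by blast
qed

lemma staircase_sum_add:
  "staircase_sum e z z' \<alpha> \<xi> \<xi>' (\<lambda>as m bs m'. H as m bs m' + H' as m bs m') U V =
   staircase_sum e z z' \<alpha> \<xi> \<xi>' H U V + staircase_sum e z z' \<alpha> \<xi> \<xi>' H' U V"
  unfolding staircase_sum_def
  by (simp add: marked_sum_add additive.add[OF additive_sg] split_sum_add)

subsection \<open>Massey inner products\<close>

theorem proposition4p10:
  fixes A :: "('r::comm_ring_1, 'a::ab_group_add) ainf_alg"
    and M :: "('r, 'a, 'm::ab_group_add) ainf_mod"
    and I :: "'a list \<Rightarrow> 'm \<Rightarrow> 'a list \<Rightarrow> 'm \<Rightarrow> 'r"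
    and B :: "('r, 'b::ab_group_add) ainf_alg"
    and N :: "('r, 'b, 'n::ab_group_add) ainf_mod"
    and J :: "'b list \<Rightarrow> 'n \<Rightarrow> 'b list \<Rightarrow> 'n \<Rightarrow> 'r"
    and f :: "'a list \<Rightarrow> 'b"
    and F :: "'a list \<Rightarrow> 'm \<Rightarrow> 'a list \<Rightarrow> 'n"
    and dI dJ dF :: int
    and k l :: nat
    and e :: "nat \<Rightarrow> int"
    and a :: "nat \<Rightarrow> 'a"
    and m :: "nat \<Rightarrow> 'm"
  assumes "ainf_triple A M dI I"
    and "ainf_triple B N dJ J"
    and "triple_morphism A M I B N J f dF F"
    and "even dF"
    and "k + l \<ge> 1"
    and "\<forall>i \<in> {1..k} \<union> {k + 2..k + l + 1}. a i \<in> component A (e i)"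
    and "\<forall>i \<in> {k + 1, k + l + 2}. m i \<in> component M (e i)"
  shows "massey_inner A M I k l e a m \<subseteq>
    massey_inner B N J k l
      (\<lambda>i. if i \<in> {k + 1, k + l + 2} then e i + dF else e i)
      (\<lambda>i. f [a i]) (\<lambda>i. F [] (m i) [])"
proof
  fix y assume "y \<in> massey_inner A M I k l e a m"
  then obtain xa xm xa' xm' where y: "y = staircase_inner I k l e xa xm xm'"
    and sys: "cyclic_defining_system A M k l e a m xa xm xa' xm'"
    unfolding massey_inner_def by blast
  define c n where "c = k + 1" and "n = k + l + 2"
  define U V where "U = [1..<k + 1]" and "V = [k + 2..<k + l + 2]"
  define e' where "e' = (\<lambda>i. if i \<in> {k + 1, k + l + 2} then e i + dF else e i)"
  define z z' where "z = e c - 1" and "z' = e n - 1"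
  have L: "order1 k l = U @ c # V" "order2 k l = V @ n # U"
    by (simp_all only: order1_eq order2_eq U_def V_def c_def n_def)
  have c: "c \<notin> set U" "c \<notin> set V" and n: "n \<notin> set U" "n \<notin> set V"
    by (auto simp: U_def V_def c_def n_def)
  have alg: "ainf_algebra B" and modM: "ainf_module A M" and modN: "ainf_module B N"
    and J: "mod_family B N (dual N) dJ J"
    and f: "ainf_morphism A B f" and F: "module_morphism A M N (shm_val (act N)) f dF F"
    using assms(1-3) by (auto simp: ainf_triple_def triple_morphism_def ainf_inner_product_def module_morphism_def)
  obtain K where K: "exact_family A M K"
    and KI: "\<And>as m bs m'. \<forall>x\<in>set as \<union> set bs. homog A x \<Longrightarrow> homog M m \<Longrightarrow> homog M m' \<Longrightarrow>
      shm_val K as m bs (snd m') = pullback_val f dF F J as m bs m' - shm_val I as m bs (snd m')"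
    using assms(3) unfolding triple_morphism_def by blast
  obtain d G where G: "mod_family A M (dual M) d G"
    and KG: "\<And>as m bs. \<forall>x\<in>set as \<union> set bs. homog A x \<Longrightarrow> homog M m \<Longrightarrow>
      shm_val K as m bs = delta A M (dual_act_val M) d G as m bs"
    using K unfolding exact_family_def by blast

  define \<alpha> \<xi> \<xi>' where "\<alpha> = entry e xa" and "\<xi> P Q = entry e xm (P @ c # Q)"
    and "\<xi>' Q P = entry e xm' (Q @ n # P)" for P Q
  have tri: "triangular_family A M (U @ c # V) c e a m xa xm" "triangular_family A M (V @ n # U) n e a m xa' xm'"
    and compat: "\<And>i j. 1 \<le> i \<Longrightarrow> i \<le> j \<Longrightarrow> j \<le> k \<Longrightarrow> xa i j = xa' i j"
      "\<And>i j. k + 2 \<le> i \<Longrightarrow> i \<le> j \<Longrightarrow> j \<le> k + l + 1 \<Longrightarrow> xa i j = xa' i j"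
    and def: "defining_family A M (U @ c # V) c e xa xm" "defining_family A M (V @ n # U) n e xa' xm'"
    using sys unfolding cyclic_defining_system_def cyclic_triangular_system_def L c_def[symmetric] n_def[symmetric]
    by auto
  \<comment> \<open>Inside \<open>U\<close> and \<open>V\<close> the compatibility of the two
    families applies, so one \<alpha> serves both.\<close>
  have \<alpha>': "entry e xa' b = \<alpha> b" if "b \<noteq> []" "sublist b V \<or> sublist b U" for b
  proof -
    have "1 \<le> hd b \<and> hd b \<le> last b \<and> last b \<le> k \<or> k + 2 \<le> hd b \<and> hd b \<le> last b \<and> last b \<le> k + l + 1"
      using that(2) sublist_upt[OF _ that(1), of 1 "k + 1", THEN conjunct2]
        sublist_upt[OF _ that(1), of "k + 2" "k + l + 2", THEN conjunct2]
      unfolding U_def V_def by (elim disjE) simp_all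
    then show ?thesis using compat by (auto simp: \<alpha>_def entry_def)
  qed
  have rep: "represents c e xa xm \<alpha> \<xi> U V" and rep': "represents n e xa' xm' \<alpha> \<xi>' V U"
    using \<alpha>' by (auto simp: represents_def \<alpha>_def \<xi>_def \<xi>'_def)
  have mc: "mod_mc A M e \<alpha> \<xi> z U V" and mc': "mod_mc A M e \<alpha> \<xi>' z' V U"
    using mod_mc_of_family[OF c rep tri(1) def(1)] mod_mc_of_family[OF n(2,1) rep' tri(2) def(2)]
    by (simp_all add: z_def z'_def)

  define \<phi> \<eta> \<eta>' where "\<phi> = push_alg e f \<alpha>" and "\<eta> = push_mod e (z + dF) F \<alpha> \<xi>"
    and "\<eta>' = push_mod e (z' + dF) F \<alpha> \<xi>'"
  \<comment> \<open>Words are recovered from end points; \<open>[i..<k + 1]\<close> is empty for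
    \<open>i = c\<close>, and \<open>[k + 2..<Suc j]\<close> for \<open>j = c\<close>. In the second
    order the label \<open>n\<close> is followed by \<open>1\<close>, so an interval ending in
    \<open>n\<close> needs its own case.\<close>
  define ya ym ym' where "ya i j = snd (\<phi> [i..<Suc j])" and "ym i j = snd (\<eta> [i..<k + 1] [k + 2..<Suc j])"
    and "ym' i j = snd (\<eta>' [i..<k + l + 2] (if j = n then [] else [1..<Suc j]))" for i j
  have mcB: "mod_mc B N e \<phi> \<eta> (z + dF) U V" and mcB': "mod_mc B N e \<phi> \<eta>' (z' + dF) V U"
    unfolding \<phi>_def \<eta>_def \<eta>'_def
    by (rule mod_mc_push[OF f alg modN F assms(4) mc], rule mod_mc_push[OF f alg modN F assms(4) mc'])
  have e'cn: "e' c = e c + dF" "e' n = e n + dF"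
    by (simp_all add: e'_def c_def n_def)
  have ee': "\<forall>i\<in>set U \<union> set V. e i = e' i"
    by (auto simp: U_def V_def e'_def)
  have sdeg: "sdeg e' b = sdeg e b" if "set b \<subseteq> set U \<union> set V" for b
    unfolding sdeg_def using that ee' by (intro arg_cong[where f = sum_list] map_cong) auto
  have \<phi>: "entry e' ya b = \<phi> b" if "b \<noteq> []" "sublist b U \<or> sublist b V" for b
  proof -
    have "b = [hd b..<Suc (last b)]"
      using that(2) sublist_upt[OF _ that(1)] unfolding U_def V_def by blast
    then have "ya (hd b) (last b) = snd (\<phi> b)" by (simp only: ya_def)
    moreover have "sdeg e' b = fst (\<phi> b)"
      using sdeg[of b] that(2) set_mono_sublist by (fastforce simp: \<phi>_def push_alg_def)
    ultimately show ?thesis by (simp add: entry_def)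
  qed
  have \<eta>: "entry e' ym (P @ c # Q) = \<eta> P Q" if PQ: "suffix P U" "prefix Q V" for P Q
  proof -
    have "hd (P @ c # Q) = hd (P @ [k + 1])"
      by (simp add: hd_append c_def)
    then have "P = [hd (P @ c # Q)..<k + 1]"
      using suffix_upt[of P 1 "k + 1"] PQ(1) unfolding U_def by simp
    moreover have "Q = [k + 2..<Suc (last (P @ c # Q))]"
    proof (cases "Q = []")
      case False
      then have "Q = [k + 2..<Suc (last Q)]" "last (P @ c # Q) = last Q"
        using prefix_upt[of Q "k + 2" "k + l + 2"] PQ(2) unfolding V_def by (blast, simp)
      then show ?thesis by (simp only:)
    qed (simp add: c_def)
    ultimately have "ym (hd (P @ c # Q)) (last (P @ c # Q)) = snd (\<eta> P Q)"
      by (simp only: ym_def)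
    moreover have "sdeg e' (P @ c # Q) = fst (\<eta> P Q)"
      using sdeg set_mono_suffix[OF PQ(1)] set_mono_prefix[OF PQ(2)]
      by (simp add: \<eta>_def push_mod_def z_def e'cn subset_trans[OF _ Un_upper1] subset_trans[OF _ Un_upper2])
    ultimately show ?thesis by (simp add: entry_def)
  qed
  have \<eta>': "entry e' ym' (Q @ n # P) = \<eta>' Q P" if PQ: "suffix Q V" "prefix P U" for P Q
  proof -
    have "hd (Q @ n # P) = hd (Q @ [k + l + 2])"
      by (simp add: hd_append n_def)
    then have "Q = [hd (Q @ n # P)..<k + l + 2]"
      using suffix_upt[of Q "k + 2" "k + l + 2"] PQ(1) unfolding V_def by simp
    moreover have "P = (if last (Q @ n # P) = n then [] else [1..<Suc (last (Q @ n # P))])"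
    proof (cases "P = []")
      case False
      then have P: "P = [1..<Suc (last P)]" "last P < k + 1"
        using prefix_upt[of P 1 "k + 1"] PQ(2) unfolding U_def by blast+
      have "last (Q @ n # P) = last P" "last P \<noteq> n"
        using False P(2) by (simp_all add: n_def)
      then show ?thesis by (simp only: if_False flip: P(1))
    qed simp
    ultimately have "ym' (hd (Q @ n # P)) (last (Q @ n # P)) = snd (\<eta>' Q P)"
      by (simp only: ym'_def)
    moreover have "sdeg e' (Q @ n # P) = fst (\<eta>' Q P)"
      using sdeg set_mono_suffix[OF PQ(1)] set_mono_prefix[OF PQ(2)]
      by (simp add: \<eta>'_def push_mod_def z'_def e'cn subset_trans[OF _ Un_upper1] subset_trans[OF _ Un_upper2])
    ultimately show ?thesis by (simp add: entry_def)
  qed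
  have repB: "represents c e' ya ym \<phi> \<eta> U V" and repB': "represents n e' ya ym' \<phi> \<eta>' V U"
    using \<phi> \<eta> \<eta>' by (auto simp: represents_def)

  \<comment> \<open>A one-letter word has a single cut, so on the diagonal only the lowest
    components of \<open>f\<close> and \<open>F\<close> contribute.\<close>
  have single: "cut_sum [i] h = h [[i]]" for i :: nat and h :: "_ \<Rightarrow> 'b"
    by (simp add: cut_sum_Cons)
  have diag_a: "ya i i = f [a i]" if "i \<in> set U \<union> set V" for i
  proof -
    have "i \<noteq> c" using that c by auto
    then have "xa i i = a i" using tri(1) that by (simp add: triangular_family_def)
    then show ?thesis
      by (simp add: ya_def \<phi>_def push_alg_def single sh_val_def \<alpha>_def entry_def sg_def)
  qed
  have diag_m: "ym c c = F [] (m c) []" "ym' n n = F [] (m n) []"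
    using tri
    by (auto simp: ym_def ym'_def \<eta>_def \<eta>'_def push_mod_def marked_sum_def shm_val_def \<xi>_def \<xi>'_def
      entry_def sg_def triangular_family_def c_def n_def)
  have diag: "\<forall>i\<in>set (U @ c # V). if i = c then ym i i = F [] (m i) [] else ya i i = f [a i]"
    and diag': "\<forall>i\<in>set (V @ n # U). if i = n then ym' i i = F [] (m i) [] else ya i i = f [a i]"
    using diag_a diag_m by auto
  \<comment> \<open>Both families of the image share \<open>ya\<close>, because
    \<open>push_alg\<close> depends only on \<alpha>; their compatibility is thus immediate.\<close>
  have "cyclic_defining_system B N k l e' (\<lambda>i. f [a i]) (\<lambda>i. F [] (m i) []) ya ym ya ym'"
    unfolding cyclic_defining_system_def cyclic_triangular_system_def L c_def[symmetric] n_def[symmetric]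
    using family_of_mod_mc[OF c repB mcB diag] family_of_mod_mc[OF n(2,1) repB' mcB' diag'] by simp
  moreover have "staircase_inner J k l e' ya ym ym' = y"
  proof -
    have "staircase_inner J k l e' ya ym ym' =
        staircase_sum e' (z + dF) (z' + dF) \<phi> \<eta> \<eta>' (\<lambda>as m bs m'. shm_val J as m bs (snd m')) U V"
      using staircase_inner_eq[of k e' ya ym \<phi> \<eta> l ya ym' \<eta>' J] repB repB'
        e'cn[unfolded c_def n_def]
      by (simp add: c_def n_def U_def V_def z_def z'_def algebra_simps del: upt_Suc)
    also have "\<dots> =
        staircase_sum e (z + dF) (z' + dF) \<phi> \<eta> \<eta>' (\<lambda>as m bs m'. shm_val J as m bs (snd m')) U V"
      by (rule staircase_sum_weight_cong[OF ee', symmetric])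
    also have "\<dots> = staircase_sum e z z' \<alpha> \<xi> \<xi>' (pullback_val f dF F J) U V"
      unfolding \<phi>_def \<eta>_def \<eta>'_def by (rule staircase_sum_pullback[OF f alg modN F assms(4) J mc mc'])
    also have "\<dots> = staircase_sum e z z' \<alpha> \<xi> \<xi>' (\<lambda>as m bs m'. shm_val I as m bs (snd m') +
        delta A M (dual_act_val M) d G as m bs (snd m')) U V"
    proof (rule staircase_sum_cong[OF mc mc'])
      fix as m bs m'
      assume h: "\<forall>x\<in>set as \<union> set bs. homog A x" "homog M m" "homog M m'"
      show "pullback_val f dF F J as m bs m' = shm_val I as m bs (snd m') +
          delta A M (dual_act_val M) d G as m bs (snd m')"
        using KI[OF h] unfolding KG[OF h(1,2)] by (simp add: algebra_simps)
    qed
    also have "\<dots> = staircase_sum e z z' \<alpha> \<xi> \<xi>' (\<lambda>as m bs m'. shm_val I as m bs (snd m')) U V"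
      by (simp add: staircase_sum_add staircase_sum_delta[OF modM G mc mc'])
    also have "\<dots> = y"
      using staircase_inner_eq[of k e xa xm \<alpha> \<xi> l xa' xm' \<xi>' I] rep rep'
      by (simp add: y c_def n_def U_def V_def z_def z'_def del: upt_Suc)
    finally show ?thesis .
  qed
  ultimately show "y \<in> massey_inner B N J k l (\<lambda>i. if i \<in> {k + 1, k + l + 2} then e i + dF else e i)
      (\<lambda>i. f [a i]) (\<lambda>i. F [] (m i) [])"
    unfolding massey_inner_def e'_def[symmetric] by blast
qed

end
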